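(* Let $n,m\in\mathbb N$; let $W_1,\dots,W_n,W'_1,\dots,W'_m\in\mathcal O_{\widetilde{\mathcal W}}$ be simple nontrivial $\widetilde{\mathcal W}$-modules; let $V,V'\in\mathcal O_{\mathcal L}$ be simple $\mathcal L$-modules; let $\lambda_1,\dots,\lambda_n\in\mathbb C^*$ be pairwise distinct and $\lambda'_1,\dots,\lambda'_m\in\mathbb C^*$ be pairwise distinct. If $W_1[\lambda_1]\otimes\cdots\otimes W_n[\lambda_n]\otimes V\cong W'_1[\lambda'_1]\otimes\cdots\otimes W'_m[\lambda'_m]\otimes V'$ as $\mathcal L$-modules, then $m=n$, $V\cong V'$, and after re-indexing the $W'_j[\lambda'_j]$ we have $\lambda_i=\lambda'_i$ and $W_i\cong W'_i$ for $i=1,\dots,n$.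
   Context: $\mathcal{L}$ has basis $\{d_n=t^{n+1}\frac{d}{dt},I_n=t^n,z_1,z_2,z_3\mid n\in\mathbb{Z}\}$ with brackets $[d_n,d_m]=(m-n)d_{m+n}+\delta_{n,-m}\frac{n^3-n}{12}z_1$, $[d_n,I_m]=mI_{m+n}+\delta_{n,-m}(n^2+n)z_2$, $[I_n,I_m]=n\delta_{n,-m}z_3$, $z_i$ central, graded by $\deg d_i=\deg I_i=i$, $\deg z_j=0$. $\widetilde{\mathcal W}=\mathbb C[t]\frac{d}{dt}+\mathbb C[t]$ (spanned by $d_i$, $i\ge-1$, $I_i$, $i\ge0$). For $L=\mathcal L$ or $\widetilde{\mathcal W}$, $\mathcal O_L$ is the category of $L$-modules in which every vector is annihilated by all homogeneous elements of sufficiently large degree. A module in $\mathcal O_{\widetilde{\mathcal W}}$ is naturally a module over $\mathbb C[[t]]\frac{d}{dt}+\mathbb C[[t]]$. For $\lambda\in\mathbb C^*$ and $W\in\mathcal O_{\widetilde{\mathcal W}}$, $W[\lambda]$ is the $\mathcal L$-module on the space $W$ with $z_i\circ w=0$, $(f(t)\frac{d}{dt})\circ w=(f(t+\lambda)\frac{d}{dt})w$, $f(t)\circ w=f(t+\lambda)w$ for $f\in\mathbb C[t,t^{-1}]$, where $(t+\lambda)^m=\sum_{i\ge0}\binom{m}{i}\lambda^{m-i}t^i\in\mathbb C[[t]]$. (Under these hypotheses both tensor products are simple $\mathcal L$-modules.) *)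

theory Defs
  imports Complex_Main "HOL-Library.Function_Algebras"
begin

text \<open>Basis of the Lie algebra L: d_n, I_n (n integer), z_1, z_2, z_3.\<close>
datatype Lb = Ld int | LI int | Lz1 | Lz2 | Lz3

text \<open>Basis elements of the subalgebra W~ = C[t]d/dt + C[t].\<close>
definition Wb :: "Lb set" where
  "Wb = {Ld n | n. n \<ge> -1} \<union> {LI n | n. n \<ge> 0}"

definition fvec :: "'a set \<Rightarrow> ('a \<Rightarrow> complex) set" where
  "fvec B = {f. finite {x. f x \<noteq> 0} \<and> {x. f x \<noteq> 0} \<subseteq> B}"

definition smul :: "complex \<Rightarrow> ('a \<Rightarrow> complex) \<Rightarrow> 'a \<Rightarrow> complex" where
  "smul c f = (\<lambda>x. c * f x)"

definition delta :: "'a \<Rightarrow> 'a \<Rightarrow> complex" where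
  "delta a = (\<lambda>x. if x = a then 1 else 0)"

text \<open>A representation: a basis set together with the action of the basis elements of L.\<close>
type_synonym 'a rep = "'a set \<times> (Lb \<Rightarrow> ('a \<Rightarrow> complex) \<Rightarrow> ('a \<Rightarrow> complex))"

definition lin_on :: "('a \<Rightarrow> complex) set \<Rightarrow> (('a \<Rightarrow> complex) \<Rightarrow> ('b \<Rightarrow> complex)) \<Rightarrow> bool" where
  "lin_on S h \<longleftrightarrow> (\<forall>f\<in>S. \<forall>g\<in>S. h (f + g) = h f + h g) \<and> (\<forall>c. \<forall>f\<in>S. h (smul c f) = smul c (h f))"

definition vsubspace :: "('a \<Rightarrow> complex) set \<Rightarrow> bool" where
  "vsubspace U \<longleftrightarrow> 0 \<in> U \<and> (\<forall>f\<in>U. \<forall>g\<in>U. f + g \<in> U) \<and> (\<forall>c. \<forall>f\<in>U. smul c f \<in> U)"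

definition Lmod :: "'a rep \<Rightarrow> bool" where
  "Lmod M \<longleftrightarrow> (case M of (B, \<rho>) \<Rightarrow>
     (\<forall>x. lin_on (fvec B) (\<rho> x) \<and> \<rho> x ` fvec B \<subseteq> fvec B) \<and>
     (\<forall>f\<in>fvec B.
       (\<forall>n m. \<rho> (Ld n) (\<rho> (Ld m) f) - \<rho> (Ld m) (\<rho> (Ld n) f) =
          smul (of_int (m - n)) (\<rho> (Ld (m + n)) f) +
          (if n = - m then smul ((of_int n ^ 3 - of_int n) / 12) (\<rho> Lz1 f) else 0)) \<and>
       (\<forall>n m. \<rho> (Ld n) (\<rho> (LI m) f) - \<rho> (LI m) (\<rho> (Ld n) f) =
          smul (of_int m) (\<rho> (LI (m + n)) f) +
          (if n = - m then smul (of_int n ^ 2 + of_int n) (\<rho> Lz2 f) else 0)) \<and>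
       (\<forall>n m. \<rho> (LI n) (\<rho> (LI m) f) - \<rho> (LI m) (\<rho> (LI n) f) =
          (if n = - m then smul (of_int n) (\<rho> Lz3 f) else 0)) \<and>
       (\<forall>z\<in>{Lz1, Lz2, Lz3}. \<forall>x. \<rho> z (\<rho> x f) = \<rho> x (\<rho> z f))))"

text \<open>W~-module (only the basis elements in Wb act; central terms vanish there).\<close>
definition Wmod :: "'a rep \<Rightarrow> bool" where
  "Wmod M \<longleftrightarrow> (case M of (B, \<rho>) \<Rightarrow>
     (\<forall>x\<in>Wb. lin_on (fvec B) (\<rho> x) \<and> \<rho> x ` fvec B \<subseteq> fvec B) \<and>
     (\<forall>f\<in>fvec B.
       (\<forall>n m. n \<ge> -1 \<longrightarrow> m \<ge> -1 \<longrightarrow>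
          \<rho> (Ld n) (\<rho> (Ld m) f) - \<rho> (Ld m) (\<rho> (Ld n) f) = smul (of_int (m - n)) (\<rho> (Ld (m + n)) f)) \<and>
       (\<forall>n m. n \<ge> -1 \<longrightarrow> m \<ge> 0 \<longrightarrow>
          \<rho> (Ld n) (\<rho> (LI m) f) - \<rho> (LI m) (\<rho> (Ld n) f) = smul (of_int m) (\<rho> (LI (m + n)) f)) \<and>
       (\<forall>n m. n \<ge> 0 \<longrightarrow> m \<ge> 0 \<longrightarrow>
          \<rho> (LI n) (\<rho> (LI m) f) = \<rho> (LI m) (\<rho> (LI n) f))))"

definition inO :: "'a rep \<Rightarrow> bool" where
  "inO M \<longleftrightarrow> (\<forall>f\<in>fvec (fst M). \<exists>N::int. \<forall>k\<ge>N. snd M (Ld k) f = 0 \<and> snd M (LI k) f = 0)"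

definition simple_for :: "Lb set \<Rightarrow> 'a rep \<Rightarrow> bool" where
  "simple_for X M \<longleftrightarrow> fvec (fst M) \<noteq> {0} \<and>
     (\<forall>U. U \<subseteq> fvec (fst M) \<and> vsubspace U \<and> (\<forall>x\<in>X. snd M x ` U \<subseteq> U) \<longrightarrow>
        U = {0} \<or> U = fvec (fst M))"

definition nontrivial_W :: "'a rep \<Rightarrow> bool" where
  "nontrivial_W M \<longleftrightarrow> (\<exists>x\<in>Wb. \<exists>f\<in>fvec (fst M). snd M x f \<noteq> 0)"

definition iso_for :: "Lb set \<Rightarrow> 'a rep \<Rightarrow> 'b rep \<Rightarrow> bool" where
  "iso_for X M M' \<longleftrightarrow> (\<exists>\<phi>. bij_betw \<phi> (fvec (fst M)) (fvec (fst M')) \<and> lin_on (fvec (fst M)) \<phi> \<and>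
     (\<forall>x\<in>X. \<forall>f\<in>fvec (fst M). \<phi> (snd M x f) = snd M' x (\<phi> f)))"

text \<open>The L-module W[lambda]. The sums are finite for W in category O;
  terms with zero vector are dropped, which does not change the sum.\<close>
definition shift :: "complex \<Rightarrow> 'a rep \<Rightarrow> 'a rep" where
  "shift lam M = (fst M, (\<lambda>x f. case x of
      Ld m \<Rightarrow> (\<Sum>i\<in>{i::nat. snd M (Ld (int i - 1)) f \<noteq> 0}.
                 smul ((of_int (m + 1) gchoose i) * lam powi (m + 1 - int i)) (snd M (Ld (int i - 1)) f))
    | LI m \<Rightarrow> (\<Sum>i\<in>{i::nat. snd M (LI (int i)) f \<noteq> 0}.
                 smul ((of_int m gchoose i) * lam powi (m - int i)) (snd M (LI (int i)) f))
    | _ \<Rightarrow> 0))"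

definition ptens :: "('w \<Rightarrow> complex) list \<Rightarrow> ('v \<Rightarrow> complex) \<Rightarrow> ('w list \<times> 'v \<Rightarrow> complex)" where
  "ptens fs g = (\<lambda>(xs, b). if length xs = length fs then (\<Prod>i<length fs. (fs ! i) (xs ! i)) * g b else 0)"

definition tens :: "nat \<Rightarrow> (nat \<Rightarrow> 'w rep) \<Rightarrow> 'v rep \<Rightarrow> ('w list \<times> 'v) rep" where
  "tens n W V =
    ({(xs, b). length xs = n \<and> (\<forall>i<n. xs ! i \<in> fst (W i)) \<and> b \<in> fst V},
     (\<lambda>x f. \<Sum>p\<in>{p. f p \<noteq> 0}. smul (f p)
        (case p of (xs, b) \<Rightarrow>
           (\<Sum>i<n. ptens (map (\<lambda>j. if j = i then snd (W i) x (delta (xs ! i)) else delta (xs ! j)) [0..<n])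
                          (delta b))
           + ptens (map (\<lambda>j. delta (xs ! j)) [0..<n]) (snd V x (delta b)))))"

end

theory Submission
  imports Defs "HOL-Computational_Algebra.Polynomial_Factorial" "HOL-Computational_Algebra.Field_as_Ring"
begin

text \<open>On the tensor product, \<open>g(t) d/dt\<close> acts on the \<open>i\<close>-th factor through the Taylor expansion of \<open>g\<close>
  at \<open>\<lambda>\<^sub>i\<close>, and on \<open>V\<close> through its expansion at \<open>0\<close>; on a given vector only finitely many Taylor
  coefficients matter. By the Chinese remainder theorem these finite jets can be prescribed
  independently at \<open>0\<close> and at all the points \<open>\<lambda>\<^sub>i\<close>, \<open>\<lambda>'\<^sub>j\<close>. Hence an isomorphism commutes with the action
  localized at each single point \<open>\<mu>\<close>, and nontriviality of the factors forces the sets of points to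
  coincide. Subtracting the localized actions, it also commutes with the action on \<open>V\<close> alone.
  As a module over one factor, the tensor product is a direct sum of copies of that factor, so
  restricting to a copy and projecting to a copy gives a nonzero homomorphism between corresponding
  simple factors, which is bijective by Schur's lemma.\<close>

subsection \<open>Prescribing jets of polynomials\<close>

text \<open>Chinese remainder theorem: by Bezout, \<open>b * Q\<close> is 1 modulo
  \<open>(t - \<nu>)^N\<close> and 0 modulo \<open>(t - \<mu>)^N\<close> at the other points; the
  extra factor \<open>(t - \<nu>)^k\<close> moves the 1 to position \<open>k\<close>. The jet at
  \<open>\<mu>\<close> is read off the coefficients of \<open>g(t + \<mu>)\<close>.\<close>

lemma poly_localizing:
  fixes \<nu> :: complex
  assumes "finite S" "k < N"
  shows "\<exists>g. \<forall>\<mu>\<in>insert \<nu> S. \<forall>l<N. coeff (pcompose g [:\<mu>, 1:]) l = (if \<mu> = \<nu> \<and> l = k then 1 else 0)"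
proof -
  define P where "P = [:-\<nu>, 1:] ^ N"
  define Q where "Q = (\<Prod>\<mu>\<in>S - {\<nu>}. [:-\<mu>, 1:] ^ N)"
  have lin: "coprime [:-\<nu>, 1:] [:-\<mu>, 1:]" if "\<mu> \<noteq> \<nu>" for \<mu>
  proof (rule coprimeI)
    fix c assume "c dvd [:-\<nu>, 1:]" "c dvd [:-\<mu>, 1:]"
    then have "c dvd [:-\<nu>, 1:] - [:-\<mu>, 1:]" by (rule dvd_diff)
    then have "c dvd [:\<mu> - \<nu>:]" by simp
    moreover have "is_unit [:\<mu> - \<nu>:]" using that by (simp add: is_unit_const_poly_iff dvd_field_iff)
    ultimately show "is_unit c" by (rule dvd_trans)
  qed
  have "coprime P Q"
    unfolding P_def Q_def by (intro prod_coprime_right) (use lin in auto)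
  then obtain a b where ab: "a * P + b * Q = 1"
    by (metis bezout_coefficients_fst_snd coprime_imp_gcd_eq_1)
  define g where "g = b * Q * [:-\<nu>, 1:] ^ k"
  have pc: "pcompose ([:-\<mu>, 1:] ^ j) [:\<mu>, 1:] = monom 1 j" for \<mu> :: complex and j
  proof -
    have "pcompose [:-\<mu>, 1:] [:\<mu>, 1:] = [:0, 1:]" by (simp add: pcompose_pCons)
    then show ?thesis
      by (induction j)
        (simp_all add: pcompose_1 pcompose_mult monom_altdef del: mult_pCons_left mult_pCons_right)
  qed
  have "coeff (pcompose g [:\<mu>, 1:]) l = (if \<mu> = \<nu> \<and> l = k then 1 else 0)"
    if "\<mu> \<in> insert \<nu> S" "l < N" for \<mu> l
  proof (cases "\<mu> = \<nu>")
    case True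
    \<comment> \<open>Since \<open>b * Q = 1 - a * P\<close>, \<open>g\<close> differs from
      \<open>(t - \<nu>)^k\<close> by a multiple of \<open>(t - \<nu>)^N\<close>, which is invisible
      in the jet below \<open>N\<close>.\<close>
    have "g = [:-\<nu>, 1:] ^ k - [:-\<nu>, 1:] ^ N * (a * [:-\<nu>, 1:] ^ k)"
      using arg_cong[OF ab, of "\<lambda>x. x * [:-\<nu>, 1:] ^ k"] unfolding g_def P_def by (simp add: algebra_simps)
    then have "pcompose g [:\<mu>, 1:] = monom 1 k - monom 1 N * pcompose (a * [:-\<nu>, 1:] ^ k) [:\<mu>, 1:]"
      using True by (simp add: pcompose_diff pcompose_mult pc)
    then show ?thesis using True that by (simp add: coeff_monom_mult)
  next
    case False
    then have "[:-\<mu>, 1:] ^ N dvd Q" unfolding Q_def using that assms by (intro dvd_prodI) auto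
    then have "[:-\<mu>, 1:] ^ N dvd g" unfolding g_def by simp
    then obtain h where "g = [:-\<mu>, 1:] ^ N * h" by (elim dvdE)
    then have "pcompose g [:\<mu>, 1:] = monom 1 N * pcompose h [:\<mu>, 1:]"
      by (simp add: pcompose_mult pc)
    then show ?thesis using False that by (simp add: coeff_monom_mult)
  qed
  then show ?thesis by blast
qed

text \<open>Binomial form of the Taylor coefficients at \<open>a\<close>, to be matched with the
  \<open>gchoose\<close> coefficients of \<open>shift\<close>. For \<open>k < l\<close> the
  truncated exponent \<open>k - l\<close> is harmless because the binomial coefficient is 0.\<close>

lemma coeff_pcompose_linear:
  fixes g :: "complex poly"
  shows "coeff (pcompose g [:a, 1:]) l = (\<Sum>k\<le>degree g. coeff g k * (of_nat (k choose l) * a ^ (k - l)))"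
proof -
  have "pcompose g [:a, 1:] = (\<Sum>k\<le>degree g. smult (coeff g k) ([:a, 1:] ^ k))"
    by (simp add: pcompose_altdef poly_altdef degree_map_poly coeff_map_poly)
  moreover have "coeff ([:a, 1:] ^ k) l = of_nat (k choose l) * a ^ (k - l)" for k
    by (cases "l \<le> k") (auto simp: coeff_linear_poly_power coeff_eq_0 degree_linear_power binomial_eq_0)
  ultimately show ?thesis by (simp add: coeff_sum)
qed 

subsection \<open>Finitely supported functions and Schur's lemma\<close>

lemma fvec_0 [simp]: "0 \<in> fvec A"
  by (simp add: fvec_def)

lemma fvec_smul: "f \<in> fvec A \<Longrightarrow> smul c f \<in> fvec A"
  by (auto simp: fvec_def smul_def elim: rev_finite_subset)

lemma fvec_add:
  assumes "f \<in> fvec A" "g \<in> fvec A"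
  shows "f + g \<in> fvec A"
proof -
  have sub: "{x. (f + g) x \<noteq> 0} \<subseteq> {x. f x \<noteq> 0} \<union> {x. g x \<noteq> 0}"
  proof
    fix x assume "x \<in> {x. (f + g) x \<noteq> 0}"
    then show "x \<in> {x. f x \<noteq> 0} \<union> {x. g x \<noteq> 0}" by (cases "f x = 0") simp_all
  qed
  moreover have "finite ({x. f x \<noteq> 0} \<union> {x. g x \<noteq> 0})" "{x. f x \<noteq> 0} \<union> {x. g x \<noteq> 0} \<subseteq> A"
    using assms by (auto simp: fvec_def)
  ultimately show ?thesis unfolding fvec_def by (blast intro: finite_subset)
qed

lemma fvec_sum: "(\<And>i. i \<in> I \<Longrightarrow> f i \<in> fvec A) \<Longrightarrow> (\<Sum>i\<in>I. f i) \<in> fvec A"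
  by (induction I rule: infinite_finite_induct) (auto intro: fvec_add)

lemma fvec_outside: "f \<in> fvec A \<Longrightarrow> a \<notin> A \<Longrightarrow> f a = 0"
  by (auto simp: fvec_def)

lemma delta_fvec: "a \<in> A \<Longrightarrow> delta a \<in> fvec A"
  by (auto simp: fvec_def delta_def)

lemma sum_fun_apply: "(\<Sum>i\<in>I. f i) x = (\<Sum>i\<in>I. f i x)" for f :: "'i \<Rightarrow> 'a \<Rightarrow> complex"
  by (induction I rule: infinite_finite_induct) auto

lemma smul_simps [simp]: "smul c 0 = 0" "smul 0 f = 0" "smul 1 f = f"
  by (auto simp: smul_def)

lemma fvec_expand:
  assumes "f \<in> fvec A"
  shows "f = (\<Sum>a\<in>{a. f a \<noteq> 0}. smul (f a) (delta a))"
proof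
  fix x
  have fin: "finite {a. f a \<noteq> 0}" using assms by (simp add: fvec_def)
  have "(\<Sum>a\<in>{a. f a \<noteq> 0}. f a * (if x = a then 1 else 0)) = f x"
    using fin by (simp add: if_distrib[of "(*) _"] sum.delta cong: if_cong)
  then show "f x = (\<Sum>a\<in>{a. f a \<noteq> 0}. smul (f a) (delta a)) x"
    by (simp add: sum_fun_apply smul_def delta_def)
qed

lemma lin_on_0: "lin_on (fvec A) h \<Longrightarrow> h 0 = 0"
  unfolding lin_on_def by (metis fvec_0 smul_simps(2))

lemma lin_on_smul: "lin_on (fvec A) h \<Longrightarrow> f \<in> fvec A \<Longrightarrow> h (smul c f) = smul c (h f)"
  by (simp add: lin_on_def)

lemma lin_on_add: "lin_on (fvec A) h \<Longrightarrow> f \<in> fvec A \<Longrightarrow> g \<in> fvec A \<Longrightarrow> h (f + g) = h f + h g"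
  by (simp add: lin_on_def)

lemma lin_on_sum:
  assumes "lin_on (fvec A) h" "\<And>i. i \<in> I \<Longrightarrow> f i \<in> fvec A"
  shows "h (\<Sum>i\<in>I. f i) = (\<Sum>i\<in>I. h (f i))"
  using assms(2)
proof (induction I rule: infinite_finite_induct)
  case (insert i I)
  then have "h (f i + sum f I) = h (f i) + h (sum f I)"
    by (intro lin_on_add[OF assms(1)] fvec_sum) auto
  with insert show ?case by (simp del: plus_fun_apply)
qed (auto simp: lin_on_0[OF assms(1)])

lemma lin_on_lincomb:
  assumes "lin_on (fvec A) h" "\<And>i. i \<in> I \<Longrightarrow> f i \<in> fvec A"
  shows "h (\<Sum>i\<in>I. smul (c i) (f i)) = (\<Sum>i\<in>I. smul (c i) (h (f i)))"
  using assms(2) by (simp add: lin_on_sum[OF assms(1)] lin_on_smul[OF assms(1)] fvec_smul cong: sum.cong)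

definition endo :: "'a set \<Rightarrow> (('a \<Rightarrow> complex) \<Rightarrow> 'a \<Rightarrow> complex) \<Rightarrow> bool" where
  "endo A R \<longleftrightarrow> lin_on (fvec A) R \<and> R ` fvec A \<subseteq> fvec A"

lemma endo_lin: "endo A R \<Longrightarrow> lin_on (fvec A) R"
  and endo_fvec: "endo A R \<Longrightarrow> f \<in> fvec A \<Longrightarrow> R f \<in> fvec A"
  by (auto simp: endo_def)

lemma endo_expand:
  assumes "endo A R" "f \<in> fvec A"
  shows "R f = (\<Sum>a\<in>{a. f a \<noteq> 0}. smul (f a) (R (delta a)))"
proof -
  have "R f = R (\<Sum>a\<in>{a. f a \<noteq> 0}. smul (f a) (delta a))"
    using fvec_expand[OF assms(2)] by simp
  also have "\<dots> = (\<Sum>a\<in>{a. f a \<noteq> 0}. smul (f a) (R (delta a)))"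
    using assms by (intro lin_on_lincomb[OF endo_lin]) (auto simp: fvec_def delta_def)
  finally show ?thesis .
qed

lemma endo_lincomb:
  assumes "\<And>i. i \<in> I \<Longrightarrow> endo A (R i)"
  shows "endo A (\<lambda>f. \<Sum>i\<in>I. smul (c i) (R i f))"
  unfolding endo_def lin_on_def
proof (intro conjI ballI allI subsetI)
  fix f g assume fg: "f \<in> fvec A" "g \<in> fvec A"
  show "(\<Sum>i\<in>I. smul (c i) (R i (f + g))) = (\<Sum>i\<in>I. smul (c i) (R i f)) + (\<Sum>i\<in>I. smul (c i) (R i g))"
    unfolding sum.distrib[symmetric]
    by (intro sum.cong refl) (use assms fg in \<open>auto simp: endo_def lin_on_def smul_def algebra_simps\<close>)
next
  fix f d assume f: "f \<in> fvec A"
  have "smul (c i) (R i (smul d f)) = smul d (smul (c i) (R i f))" if "i \<in> I" for i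
    unfolding lin_on_smul[OF endo_lin[OF assms[OF that]] f] by (simp add: smul_def algebra_simps)
  then have "(\<Sum>i\<in>I. smul (c i) (R i (smul d f))) = (\<Sum>i\<in>I. smul d (smul (c i) (R i f)))"
    by (intro sum.cong) auto
  then show "(\<Sum>i\<in>I. smul (c i) (R i (smul d f))) = smul d (\<Sum>i\<in>I. smul (c i) (R i f))"
    by (simp add: fun_eq_iff sum_fun_apply smul_def sum_distrib_left)
next
  fix x assume "x \<in> (\<lambda>f. \<Sum>i\<in>I. smul (c i) (R i f)) ` fvec A"
  then show "x \<in> fvec A" using assms by (auto intro!: fvec_sum fvec_smul simp: endo_def)
qed

text \<open>The kernel misses \<open>w\<close>, so simplicity makes it zero; the image contains
  \<open>\<psi> w\<close>, so simplicity makes it everything. A general \<open>X\<close> covers both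
  \<open>Wb\<close> (for the factors \<open>W i\<close>) and \<open>UNIV\<close> (for
  \<open>V\<close>).\<close>

lemma schur_iso:
  assumes M: "simple_for X M" and M': "simple_for X M'"
    and endo: "\<And>x. x \<in> X \<Longrightarrow> endo (fst M) (snd M x)"
    and lin: "lin_on (fvec (fst M)) \<psi>" and im: "\<psi> ` fvec (fst M) \<subseteq> fvec (fst M')"
    and hom: "\<And>x f. x \<in> X \<Longrightarrow> f \<in> fvec (fst M) \<Longrightarrow> \<psi> (snd M x f) = snd M' x (\<psi> f)"
    and endo': "\<And>x. x \<in> X \<Longrightarrow> endo (fst M') (snd M' x)"
    and nz: "w \<in> fvec (fst M)" "\<psi> w \<noteq> 0"
  shows "iso_for X M M'"
proof -
  let ?A = "fvec (fst M)" and ?A' = "fvec (fst M')"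
  define K where "K = {f \<in> ?A. \<psi> f = 0}"
  have "0 \<in> K" using lin_on_0[OF lin] by (simp add: K_def)
  moreover have "f + g \<in> K" if "f \<in> K" "g \<in> K" for f g
    using that lin_on_add[OF lin, of f g] fvec_add[of f _ g] unfolding K_def by simp
  moreover have "smul c f \<in> K" if "f \<in> K" for c f
    using that lin_on_smul[OF lin, of f c] fvec_smul[of f _ c] unfolding K_def by simp
  ultimately have "vsubspace K" by (simp add: vsubspace_def)
  moreover have "snd M x ` K \<subseteq> K" if "x \<in> X" for x
  proof
    fix h assume "h \<in> snd M x ` K"
    then obtain f where f: "f \<in> fvec (fst M)" "\<psi> f = 0" "h = snd M x f" by (auto simp: K_def)
    then show "h \<in> K"
      using hom[OF that f(1)] endo_fvec[OF endo[OF that] f(1)] lin_on_0[OF endo_lin[OF endo'[OF that]]]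
      by (simp add: K_def)
  qed
  moreover have "K \<subseteq> ?A" "K \<noteq> ?A" using nz by (auto simp: K_def)
  ultimately have K: "K = {0}" using M unfolding simple_for_def by blast
  have "vsubspace (\<psi> ` ?A)" unfolding vsubspace_def
  proof (intro conjI ballI allI)
    show "0 \<in> \<psi> ` ?A" using imageI[OF fvec_0, of \<psi> "fst M"] lin_on_0[OF lin] by simp
  next
    fix f g assume "f \<in> \<psi> ` ?A" "g \<in> \<psi> ` ?A"
    then obtain f' g' where "f' \<in> ?A" "g' \<in> ?A" "f = \<psi> f'" "g = \<psi> g'" by auto
    then show "f + g \<in> \<psi> ` ?A"
      using imageI[OF fvec_add, of f' "fst M" g' \<psi>] lin_on_add[OF lin, of f' g'] by simp
  next
    fix c f assume "f \<in> \<psi> ` ?A"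
    then obtain f' where "f' \<in> ?A" "f = \<psi> f'" by auto
    then show "smul c f \<in> \<psi> ` ?A"
      using imageI[OF fvec_smul, of f' "fst M" \<psi> c] lin_on_smul[OF lin, of f' c] by simp
  qed
  moreover have "\<forall>x\<in>X. snd M' x ` \<psi> ` ?A \<subseteq> \<psi> ` ?A"
  proof (intro ballI subsetI)
    fix x h assume x: "x \<in> X" and "h \<in> snd M' x ` \<psi> ` ?A"
    then obtain f where f: "f \<in> ?A" "h = snd M' x (\<psi> f)" by auto
    then have "h = \<psi> (snd M x f)" using hom[OF x] by simp
    then show "h \<in> \<psi> ` ?A" using endo_fvec[OF endo[OF x] f(1)] by blast
  qed
  moreover have "\<psi> ` ?A \<noteq> {0}" using nz by auto
  ultimately have surj: "\<psi> ` ?A = ?A'" using M' im unfolding simple_for_def by blast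
  have "inj_on \<psi> ?A"
  proof (rule inj_onI)
    fix f g assume fg: "f \<in> ?A" "g \<in> ?A" "\<psi> f = \<psi> g"
    have "\<psi> (f + smul (-1) g) = \<psi> f + smul (-1) (\<psi> g)"
      unfolding lin_on_smul[OF lin fg(2), symmetric]
      by (rule lin_on_add[OF lin fg(1) fvec_smul[OF fg(2)]])
    also have "\<dots> = 0" unfolding fg(3) by (rule HOL.ext) (simp add: smul_def)
    finally have "f + smul (-1) g \<in> K" using fvec_add[OF fg(1) fvec_smul[OF fg(2)]] by (simp add: K_def)
    then have "(f + smul (-1) g) x = 0" for x unfolding K by simp
    then show "f = g" by (simp add: smul_def fun_eq_iff)
  qed
  with surj lin hom show ?thesis
    unfolding iso_for_def bij_betw_def by blast
qed

subsection \<open>Operators on one tensor factor\<close>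

text \<open>A tensor factor with basis \<open>A\<close> inside a tensor product with basis \<open>B\<close> is encoded as a
  lens on basis vectors: \<open>co p\<close> reads the coordinate of \<open>p\<close> in that factor, and \<open>up p a\<close>
  replaces it by \<open>a\<close>.\<close>

locale slot =
  fixes B :: "'p set" and A :: "'a set" and up :: "'p \<Rightarrow> 'a \<Rightarrow> 'p" and co :: "'p \<Rightarrow> 'a"
  assumes up_in: "p \<in> B \<Longrightarrow> up p a \<in> B \<longleftrightarrow> a \<in> A"
    and co_in: "p \<in> B \<Longrightarrow> co p \<in> A"
    and up_co: "p \<in> B \<Longrightarrow> up p (co p) = p"
    and co_up: "p \<in> B \<Longrightarrow> a \<in> A \<Longrightarrow> co (up p a) = a"
    and up_up: "p \<in> B \<Longrightarrow> a \<in> A \<Longrightarrow> up (up p a) b = up p b"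
begin

text \<open>The slice of \<open>f\<close> along the fibre through \<open>p\<close>: the component of
  \<open>f\<close>, as a vector of the factor, at the remaining coordinates of \<open>p\<close>. It
  depends only on the fibre.\<close>

definition pr :: "'p \<Rightarrow> ('p \<Rightarrow> complex) \<Rightarrow> 'a \<Rightarrow> complex" where
  "pr p f = (\<lambda>a. f (up p a))"

text \<open>The operator acting as \<open>R\<close> on this factor and as the identity on the
  others, computed slice by slice.\<close>

definition ext :: "(('a \<Rightarrow> complex) \<Rightarrow> 'a \<Rightarrow> complex) \<Rightarrow> ('p \<Rightarrow> complex) \<Rightarrow> 'p \<Rightarrow> complex" where
  "ext R f = (\<lambda>p. if p \<in> B then R (pr p f) (co p) else 0)"

text \<open>The pure tensor with \<open>w\<close> in this factor and the basis vectors of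
  \<open>p\<close> in the others. The test \<open>q = up p (co q)\<close> says that \<open>q\<close>
  lies on the fibre through \<open>p\<close>.\<close>

definition emb :: "'p \<Rightarrow> ('a \<Rightarrow> complex) \<Rightarrow> 'p \<Rightarrow> complex" where
  "emb p w = (\<lambda>q. if q \<in> B \<and> q = up p (co q) then w (co q) else 0)"

lemma inj_up: "p \<in> B \<Longrightarrow> inj_on (up p) A"
  by (rule inj_on_inverseI[of _ co]) (rule co_up)

lemma pr_fvec:
  assumes "f \<in> fvec B" "p \<in> B"
  shows "pr p f \<in> fvec A"
proof -
  have sub: "{a. f (up p a) \<noteq> 0} \<subseteq> A" using assms up_in by (auto simp: fvec_def)
  moreover have "finite {a. f (up p a) \<noteq> 0}"
  proof (rule inj_on_finite)
    show "inj_on (up p) {a. f (up p a) \<noteq> 0}" using inj_up[OF assms(2)] sub by (rule inj_on_subset)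
    show "up p ` {a. f (up p a) \<noteq> 0} \<subseteq> {q. f q \<noteq> 0}" by auto
    show "finite {q. f q \<noteq> 0}" using assms by (simp add: fvec_def)
  qed
  ultimately show ?thesis by (simp add: fvec_def pr_def)
qed

text \<open>A nonzero slice is the slice through a point of the support of \<open>f\<close>.
  Finiteness lets one degree bound from category O serve all slices at once.\<close>

lemma finite_pr_image:
  assumes "f \<in> fvec B"
  shows "finite ((\<lambda>p. pr p f) ` B)"
proof (rule finite_subset)
  show "(\<lambda>p. pr p f) ` B \<subseteq> insert 0 ((\<lambda>p. pr p f) ` {p. f p \<noteq> 0})"
  proof
    fix h assume "h \<in> (\<lambda>p. pr p f) ` B"
    then obtain p where p: "p \<in> B" "h = pr p f" by auto
    show "h \<in> insert 0 ((\<lambda>p. pr p f) ` {p. f p \<noteq> 0})"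
    proof (cases "h = 0")
      case False
      then obtain a where a: "f (up p a) \<noteq> 0" using p by (auto simp: pr_def fun_eq_iff)
      then have "a \<in> A" using assms up_in p by (auto simp: fvec_def)
      then have "h = pr (up p a) f" using p up_up by (simp add: pr_def)
      then show ?thesis using a by blast
    qed simp
  qed
  show "finite (insert 0 ((\<lambda>p. pr p f) ` {p. f p \<noteq> 0}))" using assms by (simp add: fvec_def)
qed

text \<open>Projection to one copy of the factor is a homomorphism, because all points of a fibre
  share the same slice.\<close>

lemma pr_ext:
  assumes "endo A R" "f \<in> fvec B" "p \<in> B"
  shows "pr p (ext R f) = R (pr p f)"
proof
  fix a
  have R: "R (pr p f) \<in> fvec A" by (rule endo_fvec[OF assms(1) pr_fvec[OF assms(2,3)]])
  have *: "pr p (ext R f) a = (if up p a \<in> B then R (pr (up p a) f) (co (up p a)) else 0)"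
    by (simp add: pr_def ext_def)
  show "pr p (ext R f) a = R (pr p f) a"
  proof (cases "a \<in> A")
    case True
    then have "pr (up p a) f = pr p f" using assms by (simp add: pr_def up_up)
    then show ?thesis using assms True by (simp add: * up_in co_up)
  next
    case False
    then show ?thesis using assms fvec_outside[OF R] by (simp add: * up_in)
  qed
qed

lemma emb_fvec:
  assumes "w \<in> fvec A" "p \<in> B"
  shows "emb p w \<in> fvec B"
proof -
  have "{q. emb p w q \<noteq> 0} \<subseteq> up p ` {a. w a \<noteq> 0}" by (auto simp: emb_def split: if_splits)
  then have "finite {q. emb p w q \<noteq> 0}"
    using assms by (elim finite_subset) (simp add: fvec_def)
  then show ?thesis by (auto simp: fvec_def emb_def split: if_splits)
qed

lemma pr_emb:
  assumes "w \<in> fvec A" "p \<in> B" "r \<in> B"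
  shows "pr r (emb p w) = (if r = up p (co r) then w else 0)"
proof (intro ext)
  fix a
  show "pr r (emb p w) a = (if r = up p (co r) then w else 0) a"
  proof (cases "a \<in> A")
    case True
    \<comment> \<open>Two fibres with a common point coincide.\<close>
    have "up r a = up p a \<longleftrightarrow> r = up p (co r)"
    proof
      assume "up r a = up p a"
      then have "up (up r a) (co r) = up (up p a) (co r)" by simp
      then show "r = up p (co r)" using assms True by (simp add: up_up up_co)
    next
      assume "r = up p (co r)"
      then have "up r a = up (up p (co r)) a" by simp
      then show "up r a = up p a" using assms by (simp add: up_up co_in)
    qed
    then show ?thesis using assms True by (simp add: pr_def emb_def up_in co_up)
  next
    case False
    then show ?thesis using assms fvec_outside[OF assms(1)] by (simp add: pr_def emb_def up_in)
  qed
qed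

text \<open>Inclusion of one copy of the factor is a homomorphism: by \<open>pr_emb\<close> every
  slice of \<open>emb p w\<close> is either \<open>w\<close> or 0, and \<open>R\<close> maps 0 to
  0.\<close>

lemma ext_emb:
  assumes "endo A R" "w \<in> fvec A" "p \<in> B"
  shows "ext R (emb p w) = emb p (R w)"
  using assms by (auto simp: fun_eq_iff ext_def emb_def[of p "R w"] pr_emb lin_on_0[OF endo_lin[OF assms(1)]])

lemma emb_lin: "lin_on (fvec A) (emb p)"
  by (auto simp: lin_on_def emb_def smul_def fun_eq_iff)

lemma ext_fvec:
  assumes "endo A R" "f \<in> fvec B"
  shows "ext R f \<in> fvec B"
proof -
  \<comment> \<open>The support of the result lies on the finitely many fibres that meet the support
    of \<open>f\<close>, and on each of them it is the finite support of a vector of the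
    factor.\<close>
  let ?S = "\<Union>p\<in>{p. f p \<noteq> 0}. up p ` {a. R (pr p f) a \<noteq> 0}"
  have "{q. ext R f q \<noteq> 0} \<subseteq> ?S"
  proof
    fix q assume "q \<in> {q. ext R f q \<noteq> 0}"
    then have q: "q \<in> B" "R (pr q f) (co q) \<noteq> 0" by (auto simp: ext_def split: if_splits)
    then have "pr q f \<noteq> 0" using lin_on_0[OF endo_lin[OF assms(1)]] by auto
    then obtain a where a: "f (up q a) \<noteq> 0" by (auto simp: pr_def fun_eq_iff)
    then have "a \<in> A" using assms up_in q by (auto simp: fvec_def)
    then have "pr (up q a) f = pr q f" "up (up q a) (co q) = q"
      using q by (auto simp: pr_def up_up up_co)
    then show "q \<in> ?S" using a q by (auto intro!: bexI[of _ "up q a"] simp: image_iff) (metis)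
  qed
  moreover have "finite ?S"
  proof (intro finite_UN_I finite_imageI)
    show "finite {p. f p \<noteq> 0}" using assms by (simp add: fvec_def)
    fix p assume "p \<in> {p. f p \<noteq> 0}"
    then have "p \<in> B" using assms(2) by (auto simp: fvec_def)
    then have "R (pr p f) \<in> fvec A" by (rule endo_fvec[OF assms(1) pr_fvec[OF assms(2)]])
    then show "finite {a. R (pr p f) a \<noteq> 0}" by (simp add: fvec_def)
  qed
  ultimately have "finite {q. ext R f q \<noteq> 0}" by (rule finite_subset)
  then show ?thesis by (auto simp: fvec_def ext_def)
qed

text \<open>Links the slice description of the operator with the definition of \<open>tens\<close>,
  which sums over the support of \<open>f\<close>.\<close>

lemma ext_expand:
  assumes "endo A R" "f \<in> fvec B"
  shows "ext R f = (\<Sum>p\<in>{p. f p \<noteq> 0}. smul (f p) (emb p (R (delta (co p)))))"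
proof
  fix q
  show "ext R f q = (\<Sum>p\<in>{p. f p \<noteq> 0}. smul (f p) (emb p (R (delta (co p))))) q"
  proof (cases "q \<in> B")
    case True
    have fin: "finite {p. f p \<noteq> 0}" and sub: "{p. f p \<noteq> 0} \<subseteq> B" using assms by (auto simp: fvec_def)
    let ?Q = "{p. f p \<noteq> 0 \<and> q = up p (co q)}"
    have "ext R f q = (\<Sum>a\<in>{a. pr q f a \<noteq> 0}. smul (pr q f a) (R (delta a))) (co q)"
      using True endo_expand[OF assms(1) pr_fvec[OF assms(2) True]] by (simp add: ext_def)
    also have "\<dots> = (\<Sum>a\<in>{a. f (up q a) \<noteq> 0}. f (up q a) * R (delta a) (co q))"
      by (simp add: sum_fun_apply smul_def pr_def)
    also have "\<dots> = (\<Sum>p\<in>?Q. f p * R (delta (co p)) (co q))"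
    \<comment> \<open>Only the support points on the fibre through \<open>q\<close> contribute at
      \<open>q\<close>; \<open>up q\<close> and \<open>co\<close> match them with their coordinates
      in the factor.\<close>
    proof (rule sum.reindex_bij_witness[of _ co "up q"])
      fix a assume "a \<in> {a. f (up q a) \<noteq> 0}"
      then have a: "a \<in> A" "f (up q a) \<noteq> 0" using sub up_in True by auto
      show "co (up q a) = a" using a True by (simp add: co_up)
      show "up q a \<in> ?Q" using a True by (simp add: up_up up_co)
      show "f (up q a) * R (delta (co (up q a))) (co q) = f (up q a) * R (delta a) (co q)"
        using a True by (simp add: co_up)
    next
      fix p assume "p \<in> ?Q"
      then have p: "p \<in> B" "f p \<noteq> 0" "q = up p (co q)" using sub by auto
      then show "up q (co p) = p" using True by (metis co_in up_co up_up)
      then show "co p \<in> {a. f (up q a) \<noteq> 0}" using p by simp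
    qed
    also have "\<dots> = (\<Sum>p\<in>{p. f p \<noteq> 0}. if q = up p (co q) then f p * R (delta (co p)) (co q) else 0)"
      using fin by (simp add: sum.inter_filter[symmetric])
    also have "\<dots> = (\<Sum>p\<in>{p. f p \<noteq> 0}. smul (f p) (emb p (R (delta (co p))))) q"
      using True by (auto simp: sum_fun_apply smul_def emb_def intro!: sum.cong)
    finally show ?thesis .
  qed (simp add: ext_def sum_fun_apply smul_def emb_def)
qed

lemma pr_lin: "lin_on (fvec B) (pr p)"
  by (auto simp: lin_on_def pr_def smul_def fun_eq_iff)

end

text \<open>Composing inclusion of a copy, \<open>\<phi>\<close> and projection to a copy gives a
  homomorphism between the two simple factors; \<open>schur_iso\<close> applies once the copies are
  chosen so that it is nonzero.\<close>

lemma slot_iso: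
  fixes \<phi> :: "('p \<Rightarrow> complex) \<Rightarrow> ('q \<Rightarrow> complex)" and M :: "'a rep" and M' :: "'b rep"
  assumes "slot B (fst M) up co" "slot B' (fst M') up' co'"
    and \<phi>: "bij_betw \<phi> (fvec B) (fvec B')" "lin_on (fvec B) \<phi>"
    and M: "simple_for X M" "\<And>x. x \<in> X \<Longrightarrow> endo (fst M) (snd M x)"
    and M': "simple_for X M'" "\<And>x. x \<in> X \<Longrightarrow> endo (fst M') (snd M' x)"
    and hom: "\<And>x f. x \<in> X \<Longrightarrow> f \<in> fvec B \<Longrightarrow>
      \<phi> (slot.ext B up co (snd M x) f) = slot.ext B' up' co' (snd M' x) (\<phi> f)"
    and ne: "B \<noteq> {}"
  shows "iso_for X M M'"
proof -
  interpret s: slot B "fst M" up co by fact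
  interpret t: slot B' "fst M'" up' co' by fact
  obtain p where p: "p \<in> B" using ne by blast
  define w where "w = delta (co p)"
  have w: "w \<in> fvec (fst M)" using p s.co_in by (auto simp: w_def intro: delta_fvec)
  have \<phi>_in: "\<phi> f \<in> fvec B'" if "f \<in> fvec B" for f using \<phi>(1) that by (auto simp: bij_betw_def)
  have "s.emb p w p = 1" using p s.up_co by (simp add: s.emb_def w_def delta_def)
  then have "s.emb p w \<noteq> 0" by auto
  then have "\<phi> (s.emb p w) \<noteq> 0"
    using \<phi> lin_on_0[OF \<phi>(2)] s.emb_fvec[OF w p] by (metis bij_betw_inv_into_left fvec_0)
  \<comment> \<open>A point where the image of the embedded vector is nonzero selects the copy to
    project onto.\<close>
  then obtain q where q: "\<phi> (s.emb p w) q \<noteq> 0" by (auto simp: fun_eq_iff)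
  then have qB: "q \<in> B'" using \<phi>_in[OF s.emb_fvec[OF w p]] by (auto simp: fvec_def)
  define \<psi> where "\<psi> f = t.pr q (\<phi> (s.emb p f))" for f
  show ?thesis
  proof (rule schur_iso[OF M(1) M'(1) M(2) _ _ _ M'(2) w])
    show "lin_on (fvec (fst M)) \<psi>"
      using s.emb_lin[of p] \<phi>(2) t.pr_lin[of q] s.emb_fvec[OF _ p] \<phi>_in
      unfolding lin_on_def \<psi>_def by simp
    show "\<psi> ` fvec (fst M) \<subseteq> fvec (fst M')"
      unfolding \<psi>_def using t.pr_fvec[OF _ qB] \<phi>_in s.emb_fvec[OF _ p] by blast
    show "\<psi> (snd M x f) = snd M' x (\<psi> f)" if "x \<in> X" "f \<in> fvec (fst M)" for x f
    proof -
      have e: "s.emb p f \<in> fvec B" using that p by (intro s.emb_fvec)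
      have "\<psi> (snd M x f) = t.pr q (\<phi> (s.ext (snd M x) (s.emb p f)))"
        unfolding \<psi>_def using s.ext_emb[OF M(2) _ p] that by simp
      also have "\<dots> = snd M' x (\<psi> f)"
        unfolding \<psi>_def hom[OF that(1) e] by (rule t.pr_ext[OF M'(2)[OF that(1)] \<phi>_in[OF e] qB])
      finally show ?thesis .
    qed
    have "\<psi> w (co' q) \<noteq> 0" unfolding \<psi>_def t.pr_def using q qB t.up_co by simp
    then show "\<psi> w \<noteq> 0" by auto
  qed
qed

subsection \<open>The modules \<open>W[\<lambda>]\<close>\<close>

text \<open>Indexed by the power of \<open>t\<close>: \<open>t^z d/dt\<close> for \<open>c = True\<close>, and \<open>t^z\<close> otherwise.\<close>

definition gel :: "bool \<Rightarrow> int \<Rightarrow> Lb" where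
  "gel c z = (if c then Ld (z - 1) else LI z)"

lemma Wb_gel: "x \<in> Wb \<longleftrightarrow> (\<exists>c k. x = gel c (int k))"
proof
  assume "x \<in> Wb"
  then consider n where "x = Ld n" "n \<ge> -1" | n where "x = LI n" "n \<ge> 0" by (auto simp: Wb_def)
  then show "\<exists>c k. x = gel c (int k)"
  proof cases
    case 1
    then have "x = gel True (int (nat (n + 1)))" by (simp add: gel_def)
    then show ?thesis by blast
  next
    case 2
    then have "x = gel False (int (nat n))" by (simp add: gel_def)
    then show ?thesis by blast
  qed
next
  assume "\<exists>c k. x = gel c (int k)"
  then obtain c k where "x = gel c (int k)" by blast
  then show "x \<in> Wb" by (cases c) (auto simp: Wb_def gel_def)
qed

lemma Lb_gel_cases:
  obtains c z where "x = gel c z" | "x \<in> {Lz1, Lz2, Lz3}"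
proof (cases x)
  case (Ld n)
  then have "x = gel True (n + 1)" by (simp add: gel_def)
  then show ?thesis using that by blast
next
  case (LI n)
  then have "x = gel False n" by (simp add: gel_def)
  then show ?thesis using that by blast
qed (use that in auto)

lemma Wmod_endo: "Wmod M \<Longrightarrow> x \<in> Wb \<Longrightarrow> endo (fst M) (snd M x)"
  by (cases M) (simp add: Wmod_def endo_def)

lemma Lmod_endo: "Lmod M \<Longrightarrow> endo (fst M) (snd M x)"
  by (cases M) (simp add: Lmod_def endo_def)

lemma inO_gel:
  assumes "inO M" "f \<in> fvec (fst M)"
  shows "\<exists>N. \<forall>k\<ge>N. \<forall>c. snd M (gel c (int k)) f = 0"
proof -
  obtain N :: int where N: "\<And>k. k \<ge> N \<Longrightarrow> snd M (Ld k) f = 0 \<and> snd M (LI k) f = 0"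
    using assms unfolding inO_def by blast
  \<comment> \<open>The extra 1 compensates for \<open>gel True k\<close> being
    \<open>Ld (k - 1)\<close>.\<close>
  have "\<forall>k\<ge>nat N + 1. \<forall>c. snd M (gel c (int k)) f = 0"
    using N by (auto simp: gel_def)
  then show ?thesis by blast
qed

lemma inO_gel_finite:
  assumes "inO M" "finite F" "F \<subseteq> fvec (fst M)"
  shows "\<exists>N. \<forall>k\<ge>N. \<forall>c. \<forall>f\<in>F. snd M (gel c (int k)) f = 0"
  using assms(2,3)
proof (induction F rule: finite_induct)
  case (insert f F)
  then obtain N1 where N1: "\<forall>k\<ge>N1. \<forall>c. \<forall>f\<in>F. snd M (gel c (int k)) f = 0" by blast
  obtain N2 where N2: "\<forall>k\<ge>N2. \<forall>c. snd M (gel c (int k)) f = 0"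
    using inO_gel[OF assms(1), of f] insert.prems by blast
  have "\<forall>k\<ge>max N1 N2. \<forall>c. \<forall>f\<in>insert f F. snd M (gel c (int k)) f = 0"
    using N1 N2 by simp
  then show ?case by blast
qed simp

lemma fst_shift [simp]: "fst (shift a M) = fst M"
  by (simp add: shift_def)

lemma shift_central: "x \<in> {Lz1, Lz2, Lz3} \<Longrightarrow> snd (shift a M) x f = 0"
  by (auto simp: shift_def)

text \<open>Replaces the index set of \<open>shift\<close>, which varies with \<open>f\<close>, by
  an initial segment; the terms added are zero.\<close>

lemma shift_gel:
  assumes "\<forall>k\<ge>N. snd M (gel c (int k)) f = 0"
  shows "snd (shift a M) (gel c z) f =
    (\<Sum>i<N. smul ((of_int z gchoose i) * a powi (z - int i)) (snd M (gel c (int i)) f))"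
proof -
  have "snd (shift a M) (gel c z) f = (\<Sum>i\<in>{i. snd M (gel c (int i)) f \<noteq> 0}.
      smul ((of_int z gchoose i) * a powi (z - int i)) (snd M (gel c (int i)) f))"
    by (cases c) (simp_all add: shift_def gel_def)
  also have "\<dots> = (\<Sum>i<N. smul ((of_int z gchoose i) * a powi (z - int i)) (snd M (gel c (int i)) f))"
    using assms by (intro sum.mono_neutral_left) (auto simp: not_le[symmetric])
  finally show ?thesis .
qed

text \<open>Linearity is not immediate because the range of summation depends on the vector. On any
  finite set of vectors, however, the action agrees with one truncated sum \<open>S N\<close>, which
  is an endomorphism.\<close>

lemma endo_shift:
  assumes "inO M" "\<And>x. x \<in> Wb \<Longrightarrow> endo (fst M) (snd M x)"
  shows "endo (fst M) (snd (shift a M) x)"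
proof (cases x rule: Lb_gel_cases)
  case (1 c z)
  have gel: "endo (fst M) (snd M (gel c (int i)))" for i using assms(2) Wb_gel by blast
  define S where "S N f = (\<Sum>i<N. smul ((of_int z gchoose i) * a powi (z - int i)) (snd M (gel c (int i)) f))"
    for N :: nat and f
  have S: "endo (fst M) (S N)" for N unfolding S_def by (rule endo_lincomb) (rule gel)
  have ex: "\<exists>N. \<forall>f\<in>F. snd (shift a M) x f = S N f" if "finite F" "F \<subseteq> fvec (fst M)" for F
    using inO_gel_finite[OF assms(1) that] shift_gel[of _ M c _ a z] unfolding 1 S_def by meson
  show ?thesis unfolding endo_def lin_on_def
  proof (intro conjI ballI allI subsetI)
    fix f g assume fg: "f \<in> fvec (fst M)" "g \<in> fvec (fst M)"
    obtain N where N: "\<forall>h\<in>{f, g, f + g}. snd (shift a M) x h = S N h"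
      using ex[of "{f, g, f + g}"] fg fvec_add[OF fg] by auto
    show "snd (shift a M) x (f + g) = snd (shift a M) x f + snd (shift a M) x g"
      using N lin_on_add[OF endo_lin[OF S] fg] by simp
  next
    fix d f assume f: "f \<in> fvec (fst M)"
    obtain N where N: "\<forall>h\<in>{f, smul d f}. snd (shift a M) x h = S N h"
      using ex[of "{f, smul d f}"] f fvec_smul[OF f] by auto
    show "snd (shift a M) x (smul d f) = smul d (snd (shift a M) x f)"
      using N lin_on_smul[OF endo_lin[OF S] f] by simp
  next
    fix h assume "h \<in> snd (shift a M) x ` fvec (fst M)"
    then obtain f where f: "f \<in> fvec (fst M)" "h = snd (shift a M) x f" by auto
    obtain N where "h = S N f" using ex[of "{f}"] f by auto
    then show "h \<in> fvec (fst M)" using endo_fvec[OF S f(1)] by simp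
  qed
next
  case 2
  show ?thesis unfolding endo_def lin_on_def by (auto simp: shift_central[OF 2])
qed

text \<open>The action of \<open>g(t)\<close> on \<open>W[a]\<close> is by the Taylor expansion of \<open>g\<close> at \<open>a\<close>.\<close>

lemma shift_poly:
  assumes "\<forall>k\<ge>N. snd M (gel c (int k)) f = 0"
  shows "(\<Sum>j\<le>degree g. smul (coeff g j) (snd (shift a M) (gel c (int j)) f)) =
    (\<Sum>l<N. smul (coeff (pcompose g [:a, 1:]) l) (snd M (gel c (int l)) f))"
proof
  fix q
  \<comment> \<open>For \<open>l \<le> j\<close> the integer power is an ordinary one; for
    \<open>l > j\<close> both sides vanish with the binomial coefficient.\<close>
  have pw: "(of_int (int j) gchoose l) * a powi (int j - int l) = of_nat (j choose l) * a ^ (j - l)" for j l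
  proof (cases "l \<le> j")
    case True
    then have "int j - int l = int (j - l)" by simp
    then show ?thesis by (metis binomial_gbinomial of_int_of_nat_eq power_int_of_nat)
  next
    case False
    then have "(of_nat (j choose l) :: complex) = 0" by (simp add: binomial_eq_0)
    then show ?thesis by (metis binomial_gbinomial mult_zero_left of_int_of_nat_eq)
  qed
  have "(\<Sum>j\<le>degree g. smul (coeff g j) (snd (shift a M) (gel c (int j)) f)) q =
    (\<Sum>j\<le>degree g. \<Sum>l<N. coeff g j * (of_nat (j choose l) * a ^ (j - l)) * snd M (gel c (int l)) f q)"
    unfolding shift_gel[OF assms] pw by (simp add: sum_fun_apply smul_def sum_distrib_left mult.assoc)
  also have "\<dots> = (\<Sum>l<N. \<Sum>j\<le>degree g. coeff g j * (of_nat (j choose l) * a ^ (j - l)) * snd M (gel c (int l)) f q)"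
    by (rule sum.swap)
  also have "\<dots> = (\<Sum>l<N. smul (coeff (pcompose g [:a, 1:]) l) (snd M (gel c (int l)) f)) q"
    by (simp add: sum_fun_apply smul_def coeff_pcompose_linear sum_distrib_right)
  finally show "(\<Sum>j\<le>degree g. smul (coeff g j) (snd (shift a M) (gel c (int j)) f)) q =
    (\<Sum>l<N. smul (coeff (pcompose g [:a, 1:]) l) (snd M (gel c (int l)) f)) q" .
qed

subsection \<open>Tensor products\<close>

definition upW :: "nat \<Rightarrow> 'w list \<times> 'v \<Rightarrow> 'w \<Rightarrow> 'w list \<times> 'v" where
  "upW i p y = ((fst p)[i := y], snd p)"

definition coW :: "nat \<Rightarrow> 'w list \<times> 'v \<Rightarrow> 'w" where
  "coW i p = fst p ! i"

definition upV :: "'w list \<times> 'v \<Rightarrow> 'v \<Rightarrow> 'w list \<times> 'v" where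
  "upV p b = (fst p, b)"

lemma tens_base: "p \<in> fst (tens n W V) \<longleftrightarrow>
  length (fst p) = n \<and> (\<forall>i<n. fst p ! i \<in> fst (W i)) \<and> snd p \<in> fst V"
  by (cases p) (simp add: tens_def)

lemma slot_W: "i < n \<Longrightarrow> slot (fst (tens n W V)) (fst (W i)) (upW i) (coW i)"
  by unfold_locales (auto simp: tens_base upW_def coW_def nth_list_update)

lemma slot_V: "slot (fst (tens n W V)) (fst V) upV snd"
  by unfold_locales (auto simp: tens_base upV_def)

lemma prod_delta:
  assumes "length xs = n" "length ys = n" "i < n"
  shows "(\<Prod>j<n. (if j = i then h else delta (xs ! j)) (ys ! j)) =
    (if ys = xs[i := ys ! i] then h (ys ! i) else 0)"
proof (cases "ys = xs[i := ys ! i]")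
  case True
  have "ys ! j = xs ! j" if "j \<noteq> i" for j using that by (subst True) simp
  then have "(\<Prod>j<n. (if j = i then h else delta (xs ! j)) (ys ! j)) = (\<Prod>j<n. if j = i then h (ys ! i) else 1)"
    by (intro prod.cong) (auto simp: delta_def)
  then show ?thesis using True assms by simp
next
  case False
  then obtain j where j: "j < n" "j \<noteq> i" "ys ! j \<noteq> xs ! j"
    using assms by (metis length_list_update nth_equalityI nth_list_update_eq nth_list_update_neq)
  then have "(\<Prod>j<n. (if j = i then h else delta (xs ! j)) (ys ! j)) = 0"
    by (intro prod_zero) (auto intro!: bexI[of _ j] simp: delta_def)
  then show ?thesis using False by simp
qed

lemma prod_delta_eq:
  assumes "length xs = n" "length ys = n"
  shows "(\<Prod>j<n. delta (xs ! j) (ys ! j)) = (if ys = xs then 1 else 0)"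
proof (cases "ys = xs")
  case False
  then obtain j where "j < n" "ys ! j \<noteq> xs ! j" using assms by (metis nth_equalityI)
  then have "(\<Prod>j<n. delta (xs ! j) (ys ! j)) = 0"
    by (intro prod_zero) (auto intro!: bexI[of _ j] simp: delta_def)
  then show ?thesis using False by simp
qed (simp add: delta_def)

text \<open>By \<open>prod_delta\<close> the product of deltas forces agreement with
  \<open>p\<close> away from position \<open>i\<close>, which is the fibre condition in
  \<open>emb\<close>.\<close>

lemma ptens_W:
  assumes "p \<in> fst (tens n W V)" "i < n" "h \<in> fvec (fst (W i))"
  shows "ptens (map (\<lambda>j. if j = i then h else delta (fst p ! j)) [0..<n]) (delta (snd p)) =
    slot.emb (fst (tens n W V)) (upW i) (coW i) p h"
proof
  interpret slot "fst (tens n W V)" "fst (W i)" "upW i" "coW i" using assms(2) by (rule slot_W)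
  fix q
  show "ptens (map (\<lambda>j. if j = i then h else delta (fst p ! j)) [0..<n]) (delta (snd p)) q = emb p h q"
  proof (cases "length (fst q) = n")
    case len: True
    have l: "ptens (map (\<lambda>j. if j = i then h else delta (fst p ! j)) [0..<n]) (delta (snd p)) q =
      (\<Prod>j<n. (if j = i then h else delta (fst p ! j)) (fst q ! j)) * delta (snd p) (snd q)"
      using len by (cases q) (auto simp: ptens_def intro!: prod.cong)
    have pn: "length (fst p) = n" using assms(1) by (simp add: tens_base)
    have eq: "q = upW i p (coW i q) \<longleftrightarrow> fst q = (fst p)[i := fst q ! i] \<and> snd q = snd p"
      by (cases q) (auto simp: upW_def coW_def)
    show ?thesis
    proof (cases "q = upW i p (coW i q)")
      case True
      \<comment> \<open>On the fibre, leaving the basis means leaving the basis of the factor, where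
        \<open>h\<close> vanishes, so the membership test in \<open>emb\<close> cuts nothing
        off.\<close>
      have "q \<in> fst (tens n W V) \<longleftrightarrow> coW i q \<in> fst (W i)" using up_in[OF assms(1)] True by metis
      then have "emb p h q = h (coW i q)" using True fvec_outside[OF assms(3)] by (simp add: emb_def)
      then show ?thesis using True eq unfolding l prod_delta[OF pn len assms(2)]
        by (simp add: coW_def delta_def)
    next
      case False
      then show ?thesis using eq unfolding l prod_delta[OF pn len assms(2)]
        by (auto simp: emb_def delta_def)
    qed
  next
    case False
    then show ?thesis by (cases q) (auto simp: ptens_def emb_def tens_base)
  qed
qed

lemma ptens_V:
  assumes "p \<in> fst (tens n W V)" "h \<in> fvec (fst V)"
  shows "ptens (map (\<lambda>j. delta (fst p ! j)) [0..<n]) h = slot.emb (fst (tens n W V)) upV snd p h"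
proof
  interpret slot "fst (tens n W V)" "fst V" upV snd by (rule slot_V)
  fix q
  show "ptens (map (\<lambda>j. delta (fst p ! j)) [0..<n]) h q = emb p h q"
  proof (cases "length (fst q) = n")
    case len: True
    have l: "ptens (map (\<lambda>j. delta (fst p ! j)) [0..<n]) h q =
      (\<Prod>j<n. delta (fst p ! j) (fst q ! j)) * h (snd q)"
      using len by (cases q) (simp add: ptens_def)
    have pn: "length (fst p) = n" using assms(1) by (simp add: tens_base)
    have eq: "q = upV p (snd q) \<longleftrightarrow> fst q = fst p" by (cases q) (auto simp: upV_def)
    show ?thesis
    proof (cases "q = upV p (snd q)")
      case True
      have "q \<in> fst (tens n W V) \<longleftrightarrow> snd q \<in> fst V" using up_in[OF assms(1)] True by metis
      then have "emb p h q = h (snd q)" using True fvec_outside[OF assms(2)] by (simp add: emb_def)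
      then show ?thesis using True eq unfolding l prod_delta_eq[OF pn len] by simp
    next
      case False
      then show ?thesis using eq unfolding l prod_delta_eq[OF pn len] by (simp add: emb_def)
    qed
  next
    case False
    then show ?thesis by (cases q) (auto simp: ptens_def emb_def tens_base)
  qed
qed

abbreviation extW where "extW n W V i \<equiv> slot.ext (fst (tens n W V)) (upW i) (coW i)"
abbreviation extV where "extV n W V \<equiv> slot.ext (fst (tens n W V)) upV snd"

text \<open>Each summand in \<open>tens\<close> is a sum of embedded vectors by
  \<open>ptens_W\<close> and \<open>ptens_V\<close>; collecting them slot by slot with
  \<open>ext_expand\<close> turns the Leibniz rule into an identity of operators.\<close>

lemma tens_action:
  assumes W: "\<And>i. i < n \<Longrightarrow> endo (fst (W i)) (snd (W i) x)" and V: "endo (fst V) (snd V x)"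
    and f: "f \<in> fvec (fst (tens n W V))"
  shows "snd (tens n W V) x f = (\<Sum>i<n. extW n W V i (snd (W i) x) f) + extV n W V (snd V x) f"
proof -
  let ?B = "fst (tens n W V)" and ?S = "{p. f p \<noteq> 0}"
  let ?eW = "\<lambda>i p. slot.emb ?B (upW i) (coW i) p (snd (W i) x (delta (coW i p)))"
  let ?eV = "\<lambda>p. slot.emb ?B upV snd p (snd V x (delta (snd p)))"
  have sub: "?S \<subseteq> ?B" using f by (simp add: fvec_def)
  let ?G = "\<lambda>p. case p of (xs, b) \<Rightarrow>
      (\<Sum>i<n. ptens (map (\<lambda>j. if j = i then snd (W i) x (delta (xs ! i)) else delta (xs ! j)) [0..<n]) (delta b))
      + ptens (map (\<lambda>j. delta (xs ! j)) [0..<n]) (snd V x (delta b))"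
  have summand: "?G p = (\<Sum>i<n. ?eW i p) + ?eV p"
    if "p \<in> ?S" for p
  proof -
    have p: "p \<in> ?B" using that sub by blast
    have pW: "ptens (map (\<lambda>j. if j = i then snd (W i) x (delta (fst p ! i)) else delta (fst p ! j)) [0..<n]) (delta (snd p)) = ?eW i p"
      if "i < n" for i
      unfolding coW_def using p that
      by (subst ptens_W[OF p that]) (auto simp: tens_base coW_def[abs_def] intro!: endo_fvec[OF W] delta_fvec)
    have pV: "ptens (map (\<lambda>j. delta (fst p ! j)) [0..<n]) (snd V x (delta (snd p))) = ?eV p"
      using p by (intro ptens_V endo_fvec[OF V] delta_fvec) (auto simp: tens_base)
    have "(\<Sum>i<n. ptens (map (\<lambda>j. if j = i then snd (W i) x (delta (fst p ! i)) else delta (fst p ! j)) [0..<n]) (delta (snd p))) =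
      (\<Sum>i<n. ?eW i p)"
      using pW by (intro sum.cong) auto
    then show ?thesis unfolding case_prod_beta pV by simp
  qed
  have "snd (tens n W V) x f = (\<Sum>p\<in>?S. smul (f p) (?G p))"
    by (simp add: tens_def)
  also have "\<dots> = (\<Sum>p\<in>?S. smul (f p) ((\<Sum>i<n. ?eW i p) + ?eV p))"
    by (intro sum.cong refl) (simp only: summand)
  also have "\<dots> = (\<Sum>i<n. \<Sum>p\<in>?S. smul (f p) (?eW i p)) + (\<Sum>p\<in>?S. smul (f p) (?eV p))"
  proof
    fix q
    have "(\<Sum>p\<in>?S. \<Sum>i<n. f p * ?eW i p q) = (\<Sum>i<n. \<Sum>p\<in>?S. f p * ?eW i p q)" by (rule sum.swap)
    then show "(\<Sum>p\<in>?S. smul (f p) ((\<Sum>i<n. ?eW i p) + ?eV p)) q =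
      ((\<Sum>i<n. \<Sum>p\<in>?S. smul (f p) (?eW i p)) + (\<Sum>p\<in>?S. smul (f p) (?eV p))) q"
      by (simp add: sum_fun_apply smul_def distrib_left sum.distrib sum_distrib_left)
  qed
  also have "\<dots> = (\<Sum>i<n. extW n W V i (snd (W i) x) f) + extV n W V (snd V x) f"
    using slot.ext_expand[OF slot_W W f] slot.ext_expand[OF slot_V V f] by simp
  finally show ?thesis .
qed

subsection \<open>Localizing the action at a point\<close>

locale tensmod =
  fixes n :: nat and W :: "nat \<Rightarrow> 'w rep" and V :: "'v rep" and lam :: "nat \<Rightarrow> complex"
  assumes W_endo: "\<And>i x. i < n \<Longrightarrow> x \<in> Wb \<Longrightarrow> endo (fst (W i)) (snd (W i) x)"
    and W_inO: "\<And>i. i < n \<Longrightarrow> inO (W i)"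
    and V_endo: "\<And>x. endo (fst V) (snd V x)"
    and V_inO: "inO V"
begin

abbreviation sW :: "nat \<Rightarrow> 'w rep" where "sW i \<equiv> shift (lam i) (W i)"
abbreviation B :: "('w list \<times> 'v) set" where "B \<equiv> fst (tens n sW V)"
abbreviation Z where "Z \<equiv> snd (tens n sW V)"
abbreviation prW where "prW i \<equiv> slot.pr (upW i)"
abbreviation prV where "prV \<equiv> slot.pr upV"
abbreviation eW where "eW i \<equiv> extW n sW V i"
abbreviation eV where "eV \<equiv> extV n sW V"

text \<open>The original action of the \<open>W i\<close> appears here, so \<open>t^k\<close> stands
  for \<open>(t - \<mu>)^k\<close> in the coordinate of the tensor product. Summing over all indices
  with \<open>lam i = \<mu>\<close> gives a meaning to every \<open>\<mu>\<close>: the sum is empty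
  when \<open>\<mu>\<close> is not one of the points.\<close>

definition loc :: "complex \<Rightarrow> Lb \<Rightarrow> ('w list \<times> 'v \<Rightarrow> complex) \<Rightarrow> 'w list \<times> 'v \<Rightarrow> complex" where
  "loc \<mu> x f = (\<Sum>i\<in>{i. i < n \<and> lam i = \<mu>}. eW i (snd (W i) x) f)"

lemma sW_endo: "i < n \<Longrightarrow> endo (fst (W i)) (snd (sW i) x)"
  by (rule endo_shift[OF W_inO W_endo])

lemma slotW: "i < n \<Longrightarrow> slot B (fst (W i)) (upW i) (coW i)"
  using slot_W[of i n sW V] by simp

lemma slotV: "slot B (fst V) upV snd"
  by (rule slot_V)

lemma eW_apply: "i < n \<Longrightarrow> eW i R f p = (if p \<in> B then R (prW i p f) (coW i p) else 0)"
  by (simp add: slot.ext_def[OF slotW])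

lemma eV_apply: "eV R f p = (if p \<in> B then R (prV p f) (snd p) else 0)"
  by (simp add: slot.ext_def[OF slotV])

lemma Z_eq: "f \<in> fvec B \<Longrightarrow> Z x f = (\<Sum>i<n. eW i (snd (sW i) x) f) + eV (snd V x) f"
  by (rule tens_action) (auto intro: sW_endo V_endo)

lemma eW_fvec: "i < n \<Longrightarrow> f \<in> fvec B \<Longrightarrow> x \<in> Wb \<Longrightarrow> eW i (snd (W i) x) f \<in> fvec B"
  by (rule slot.ext_fvec[OF slotW W_endo])

lemma eW_sfvec: "i < n \<Longrightarrow> f \<in> fvec B \<Longrightarrow> eW i (snd (sW i) x) f \<in> fvec B"
  by (rule slot.ext_fvec[OF slotW sW_endo])

lemma eV_fvec: "f \<in> fvec B \<Longrightarrow> eV (snd V x) f \<in> fvec B"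
  by (rule slot.ext_fvec[OF slotV V_endo])

lemma Z_fvec: "f \<in> fvec B \<Longrightarrow> Z x f \<in> fvec B"
  unfolding Z_eq by (intro fvec_add fvec_sum eW_sfvec eV_fvec) auto

lemma loc_eq_eW:
  assumes "i < n" "inj_on lam {..<n}"
  shows "loc (lam i) x f = eW i (snd (W i) x) f"
proof -
  have "{j. j < n \<and> lam j = lam i} = {i}" using assms by (auto simp: inj_on_def)
  then show ?thesis by (simp add: loc_def)
qed

lemma pr_annihilated:
  assumes f: "f \<in> fvec B"
  shows "\<exists>N. \<forall>k\<ge>N. \<forall>c. \<forall>p\<in>B. (\<forall>i<n. snd (W i) (gel c (int k)) (prW i p f) = 0) \<and>
    snd V (gel c (int k)) (prV p f) = 0"
proof -
  have "\<exists>N. \<forall>k\<ge>N. \<forall>c. \<forall>h\<in>(\<lambda>p. prW i p f) ` B. snd (W i) (gel c (int k)) h = 0" if "i < n" for i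
    by (rule inO_gel_finite[OF W_inO[OF that] slot.finite_pr_image[OF slotW[OF that] f]])
      (rule image_subsetI, rule slot.pr_fvec[OF slotW[OF that] f])
  then have "\<forall>i. \<exists>N. i < n \<longrightarrow> (\<forall>k\<ge>N. \<forall>c. \<forall>h\<in>(\<lambda>p. prW i p f) ` B. snd (W i) (gel c (int k)) h = 0)"
    by blast
  from choice[OF this] obtain NW where NW: "\<And>i k c p. i < n \<Longrightarrow> k \<ge> NW i \<Longrightarrow> p \<in> B \<Longrightarrow>
      snd (W i) (gel c (int k)) (prW i p f) = 0"
    by blast
  have "\<exists>N. \<forall>k\<ge>N. \<forall>c. \<forall>h\<in>(\<lambda>p. prV p f) ` B. snd V (gel c (int k)) h = 0"
    by (rule inO_gel_finite[OF V_inO slot.finite_pr_image[OF slotV f]])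
      (rule image_subsetI, rule slot.pr_fvec[OF slotV f])
  then obtain NV where NV: "\<And>k c p. k \<ge> NV \<Longrightarrow> p \<in> B \<Longrightarrow> snd V (gel c (int k)) (prV p f) = 0"
    by blast
  \<comment> \<open>The sum of the bounds dominates each of them.\<close>
  let ?N = "(\<Sum>i<n. NW i) + NV"
  have le: "NW i \<le> ?N" if "i < n" for i
    using member_le_sum[of i "{..<n}" NW] that by simp
  show ?thesis
  proof (intro exI[of _ ?N] allI impI ballI conjI)
    fix k c p i assume "?N \<le> k" "p \<in> B" "i < n"
    then show "snd (W i) (gel c (int k)) (prW i p f) = 0" using NW le order_trans by blast
  next
    fix k c p assume "?N \<le> k" "p \<in> B"
    then show "snd V (gel c (int k)) (prV p f) = 0" by (intro NV) simp_all
  qed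
qed

text \<open>A polynomial vanishing to high order at \<open>0\<close> and at every \<open>lam i \<noteq> \<mu>\<close>, and agreeing with
  \<open>(t - \<mu>)^k\<close> to high order at \<open>\<mu>\<close>, acts only through the tensor factors based at \<open>\<mu>\<close>.\<close>

lemma localize:
  assumes f: "f \<in> fvec B"
  shows "\<exists>N0. \<forall>N\<ge>N0. \<forall>k<N. \<forall>g. (\<forall>l<N. coeff g l = 0) \<longrightarrow>
    (\<forall>i<n. \<forall>l<N. coeff (pcompose g [:lam i, 1:]) l = (if lam i = \<mu> \<and> l = k then 1 else 0)) \<longrightarrow>
    (\<Sum>j\<le>degree g. smul (coeff g j) (Z (gel c (int j)) f)) = loc \<mu> (gel c (int k)) f"
proof -
  obtain N0 where N0: "\<And>k p i. k \<ge> N0 \<Longrightarrow> p \<in> B \<Longrightarrow> i < n \<Longrightarrow> snd (W i) (gel c (int k)) (prW i p f) = 0"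
    "\<And>k p. k \<ge> N0 \<Longrightarrow> p \<in> B \<Longrightarrow> snd V (gel c (int k)) (prV p f) = 0"
    using pr_annihilated[OF f] by blast
  have "(\<Sum>j\<le>degree g. smul (coeff g j) (Z (gel c (int j)) f)) = loc \<mu> (gel c (int k)) f"
    if N: "N \<ge> N0" and k: "k < N" and g0: "\<And>l. l < N \<Longrightarrow> coeff g l = 0"
      and g: "\<And>i l. i < n \<Longrightarrow> l < N \<Longrightarrow>
        coeff (pcompose g [:lam i, 1:]) l = (if lam i = \<mu> \<and> l = k then 1 else 0)"
    for N k g
  proof
    fix p
    show "(\<Sum>j\<le>degree g. smul (coeff g j) (Z (gel c (int j)) f)) p = loc \<mu> (gel c (int k)) f p"
    proof (cases "p \<in> B")
      case False
      then show ?thesis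
        by (simp add: Z_eq[OF f] loc_def sum_fun_apply smul_def eW_apply eV_apply)
    next
      case p: True
      \<comment> \<open>On \<open>V\<close> the coefficients of \<open>g\<close> itself matter:
        those below \<open>N\<close> are zero, and the others multiply elements that annihilate the
        slice.\<close>
      have vp: "coeff g j * snd V (gel c (int j)) (prV p f) (snd p) = 0" for j
        using g0[of j] N0(2)[OF _ p, of j] N by (cases "j < N") auto
      \<comment> \<open>By \<open>shift_poly\<close> the \<open>i\<close>-th factor sees only the
        jet of \<open>g\<close> at \<open>lam i\<close>, which is \<open>t^k\<close> if
        \<open>lam i = \<mu>\<close> and zero otherwise.\<close>
      have wp: "(\<Sum>j\<le>degree g. coeff g j * snd (sW i) (gel c (int j)) (prW i p f) (coW i p)) =
        (if lam i = \<mu> then snd (W i) (gel c (int k)) (prW i p f) (coW i p) else 0)" if "i < n" for i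
      proof -
        have "\<forall>k\<ge>N. snd (W i) (gel c (int k)) (prW i p f) = 0" using N0(1) p that N by simp
        from fun_cong[OF shift_poly[OF this, of g "lam i"], of "coW i p"]
        have "(\<Sum>j\<le>degree g. coeff g j * snd (sW i) (gel c (int j)) (prW i p f) (coW i p)) =
          (\<Sum>l<N. coeff (pcompose g [:lam i, 1:]) l * snd (W i) (gel c (int l)) (prW i p f) (coW i p))"
          by (simp add: sum_fun_apply smul_def)
        also have "\<dots> = (\<Sum>l<N. if l = k then
            (if lam i = \<mu> then snd (W i) (gel c (int k)) (prW i p f) (coW i p) else 0) else 0)"
          using g[OF that] by (intro sum.cong) auto
        also have "\<dots> = (if lam i = \<mu> then snd (W i) (gel c (int k)) (prW i p f) (coW i p) else 0)"
          using k by simp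
        finally show ?thesis .
      qed
      have "(\<Sum>j\<le>degree g. smul (coeff g j) (Z (gel c (int j)) f)) p =
        (\<Sum>j\<le>degree g. \<Sum>i<n. coeff g j * snd (sW i) (gel c (int j)) (prW i p f) (coW i p))"
        using p by (simp add: Z_eq[OF f] sum_fun_apply smul_def eW_apply eV_apply distrib_left vp sum_distrib_left)
      also have "\<dots> = (\<Sum>i<n. \<Sum>j\<le>degree g. coeff g j * snd (sW i) (gel c (int j)) (prW i p f) (coW i p))"
        by (rule sum.swap)
      also have "\<dots> = (\<Sum>i<n. if lam i = \<mu> then snd (W i) (gel c (int k)) (prW i p f) (coW i p) else 0)"
        using wp by simp
      also have "\<dots> = (\<Sum>i\<in>{i\<in>{..<n}. lam i = \<mu>}. snd (W i) (gel c (int k)) (prW i p f) (coW i p))"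
        by (rule sum.inter_filter[symmetric]) simp
      also have "\<dots> = loc \<mu> (gel c (int k)) f p"
        using p by (simp add: loc_def sum_fun_apply eW_apply)
      finally show ?thesis .
    qed
  qed
  then show ?thesis by (intro exI[of _ N0] allI impI) simp
qed

text \<open>Expresses the action of every \<open>t^z\<close>, also with negative \<open>z\<close>,
  through elements of \<open>Wb\<close>, with one truncation valid on all slices. This later extends
  intertwining from \<open>Wb\<close> to all of L.\<close>

lemma eW_shift:
  assumes f: "f \<in> fvec B" and i: "i < n"
  shows "\<exists>N0. \<forall>N\<ge>N0. eW i (snd (sW i) (gel c z)) f =
    (\<Sum>l<N. smul ((of_int z gchoose l) * lam i powi (z - int l)) (eW i (snd (W i) (gel c (int l))) f))"
proof -
  obtain N0 where N0: "\<And>k p. k \<ge> N0 \<Longrightarrow> p \<in> B \<Longrightarrow> snd (W i) (gel c (int k)) (prW i p f) = 0"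
    using pr_annihilated[OF f] i by blast
  have "eW i (snd (sW i) (gel c z)) f =
    (\<Sum>l<N. smul ((of_int z gchoose l) * lam i powi (z - int l)) (eW i (snd (W i) (gel c (int l))) f))"
    if "N \<ge> N0" for N
  proof
    fix p
    show "eW i (snd (sW i) (gel c z)) f p =
      (\<Sum>l<N. smul ((of_int z gchoose l) * lam i powi (z - int l)) (eW i (snd (W i) (gel c (int l))) f)) p"
    proof (cases "p \<in> B")
      case True
      then have "\<forall>k\<ge>N. snd (W i) (gel c (int k)) (prW i p f) = 0" using N0 that by simp
      from shift_gel[OF this] True i show ?thesis
        by (simp add: eW_apply sum_fun_apply smul_def)
    qed (simp add: eW_apply sum_fun_apply smul_def i)
  qed
  then show ?thesis by blast
qed

lemma eW_nonzero:
  assumes i: "i < n" and x: "x \<in> Wb" and w: "w \<in> fvec (fst (W i))" "snd (W i) x w \<noteq> 0" and ne: "B \<noteq> {}"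
  shows "\<exists>f\<in>fvec B. eW i (snd (W i) x) f \<noteq> 0"
proof -
  interpret slot B "fst (W i)" "upW i" "coW i" by (rule slotW[OF i])
  obtain p where p: "p \<in> B" using ne by blast
  have e: "endo (fst (W i)) (snd (W i) x)" using W_endo i x .
  have "pr p (ext (snd (W i) x) (emb p w)) = snd (W i) x w"
    unfolding ext_emb[OF e w(1) p] pr_emb[OF endo_fvec[OF e w(1)] p p] using up_co[OF p] by simp
  then have "ext (snd (W i) x) (emb p w) \<noteq> 0" using w(2) by (auto simp: pr_def zero_fun_def)
  then show ?thesis using emb_fvec[OF w(1) p] by blast
qed

lemma B_nonempty:
  assumes "\<And>i. i < n \<Longrightarrow> fvec (fst (W i)) \<noteq> {0}" "fvec (fst V) \<noteq> {0}"
  shows "B \<noteq> {}"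
proof -
  have ne: "A \<noteq> {}" if "fvec A \<noteq> {0}" for A :: "'z set"
  proof
    assume "A = {}"
    then have "fvec A = {0}" by (auto simp: fvec_def fun_eq_iff)
    then show False using that by simp
  qed
  have "\<forall>i<n. \<exists>a. a \<in> fst (W i)" using ne[OF assms(1)] by blast
  then obtain a where a: "\<And>i. i < n \<Longrightarrow> a i \<in> fst (W i)" by metis
  obtain b where "b \<in> fst V" using ne[OF assms(2)] by blast
  then have "(map a [0..<n], b) \<in> B" using a by (simp add: tens_base)
  then show ?thesis by blast
qed

end

text \<open>By \<open>localize\<close>, one polynomial \<open>g\<close> writes the localized
  operators on both sides as the same linear combination of actions of L, and \<open>\<phi>\<close>
  commutes with each of these.\<close>

lemma loc_intertwine:
  assumes "tensmod n W V" "tensmod m W' V'"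
    and bij: "bij_betw \<phi> (fvec (fst (tens n (\<lambda>i. shift (lam i) (W i)) V)))
      (fvec (fst (tens m (\<lambda>j. shift (lam' j) (W' j)) V')))"
    and lin: "lin_on (fvec (fst (tens n (\<lambda>i. shift (lam i) (W i)) V))) \<phi>"
    and hom: "\<And>x f. f \<in> fvec (fst (tens n (\<lambda>i. shift (lam i) (W i)) V)) \<Longrightarrow>
      \<phi> (snd (tens n (\<lambda>i. shift (lam i) (W i)) V) x f) =
      snd (tens m (\<lambda>j. shift (lam' j) (W' j)) V') x (\<phi> f)"
    and \<mu>: "\<mu> \<noteq> 0" and x: "x \<in> Wb"
    and f: "f \<in> fvec (fst (tens n (\<lambda>i. shift (lam i) (W i)) V))"
  shows "\<phi> (tensmod.loc n W V lam \<mu> x f) = tensmod.loc m W' V' lam' \<mu> x (\<phi> f)"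
proof -
  interpret T: tensmod n W V lam by fact
  interpret T': tensmod m W' V' lam' by fact
  obtain c k where ck: "x = gel c (int k)" using x Wb_gel by blast
  have f': "\<phi> f \<in> fvec T'.B" using bij f by (auto simp: bij_betw_def)
  from T.localize[OF f, of \<mu> c] obtain N1 where N1: "\<forall>N\<ge>N1. \<forall>k<N. \<forall>g. (\<forall>l<N. coeff g l = 0) \<longrightarrow>
    (\<forall>i<n. \<forall>l<N. coeff (pcompose g [:lam i, 1:]) l = (if lam i = \<mu> \<and> l = k then 1 else 0)) \<longrightarrow>
    (\<Sum>j\<le>degree g. smul (coeff g j) (T.Z (gel c (int j)) f)) = T.loc \<mu> (gel c (int k)) f" ..
  from T'.localize[OF f', of \<mu> c] obtain N2 where N2: "\<forall>N\<ge>N2. \<forall>k<N. \<forall>g. (\<forall>l<N. coeff g l = 0) \<longrightarrow>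
    (\<forall>i<m. \<forall>l<N. coeff (pcompose g [:lam' i, 1:]) l = (if lam' i = \<mu> \<and> l = k then 1 else 0)) \<longrightarrow>
    (\<Sum>j\<le>degree g. smul (coeff g j) (T'.Z (gel c (int j)) (\<phi> f))) = T'.loc \<mu> (gel c (int k)) (\<phi> f)" ..
  define N where "N = Suc (N1 + N2 + k)"
  \<comment> \<open>Including 0 makes \<open>g\<close> vanish to order \<open>N\<close> at 0, since
    \<open>\<mu> \<noteq> 0\<close>; this switches off \<open>V\<close> and \<open>V'\<close>. The
    points of both sides are included so that a single \<open>g\<close> serves both.\<close>
  let ?S = "insert 0 (lam ` {..<n} \<union> lam' ` {..<m})"
  have "finite ?S" "k < N" by (simp_all add: N_def)
  from poly_localizing[OF this, of \<mu>] obtain g where g: "\<forall>\<nu>\<in>insert \<mu> ?S. \<forall>l<N.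
      coeff (pcompose g [:\<nu>, 1:]) l = (if \<nu> = \<mu> \<and> l = k then 1 else 0)" ..
  have g0: "\<forall>l<N. coeff g l = 0" using g \<mu> by simp
  have "\<phi> (T.loc \<mu> x f) = \<phi> (\<Sum>j\<le>degree g. smul (coeff g j) (T.Z (gel c (int j)) f))"
    using N1[rule_format, of N k g] g0 g by (simp add: N_def ck)
  also have "\<dots> = (\<Sum>j\<le>degree g. smul (coeff g j) (\<phi> (T.Z (gel c (int j)) f)))"
    by (rule lin_on_lincomb[OF lin]) (rule T.Z_fvec[OF f])
  also have "\<dots> = (\<Sum>j\<le>degree g. smul (coeff g j) (T'.Z (gel c (int j)) (\<phi> f)))"
    using hom[OF f] by simp
  also have "\<dots> = T'.loc \<mu> x (\<phi> f)"
    using N2[rule_format, of N k g] g0 g by (simp add: N_def ck)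
  finally show ?thesis .
qed

text \<open>If \<open>lam i\<close> were not a point of the other side, the localized operators
  there would be empty sums. Injectivity of \<open>\<phi>\<close> would then make \<open>Wb\<close>
  act by zero on the \<open>i\<close>-th factor, against nontriviality.\<close>

lemma lam_subset:
  assumes T: "tensmod n W V" and T': "tensmod m W' V'"
    and bij: "bij_betw \<phi> (fvec (fst (tens n (\<lambda>i. shift (lam i) (W i)) V)))
      (fvec (fst (tens m (\<lambda>j. shift (lam' j) (W' j)) V')))"
    and lin: "lin_on (fvec (fst (tens n (\<lambda>i. shift (lam i) (W i)) V))) \<phi>"
    and hom: "\<And>x f. f \<in> fvec (fst (tens n (\<lambda>i. shift (lam i) (W i)) V)) \<Longrightarrow>
      \<phi> (snd (tens n (\<lambda>i. shift (lam i) (W i)) V) x f) =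
      snd (tens m (\<lambda>j. shift (lam' j) (W' j)) V') x (\<phi> f)"
    and lam: "\<And>i. i < n \<Longrightarrow> lam i \<noteq> 0" "inj_on lam {..<n}"
    and nontriv: "\<And>i. i < n \<Longrightarrow> nontrivial_W (W i)"
    and ne: "fst (tens n (\<lambda>i. shift (lam i) (W i)) V) \<noteq> {}"
  shows "lam ` {..<n} \<subseteq> lam' ` {..<m}"
proof (rule image_subsetI, rule ccontr)
  interpret T: tensmod n W V lam by fact
  interpret T': tensmod m W' V' lam' by fact
  fix i assume "i \<in> {..<n}" and nin: "lam i \<notin> lam' ` {..<m}"
  then have i: "i < n" by simp
  obtain x w where x: "x \<in> Wb" "w \<in> fvec (fst (W i))" "snd (W i) x w \<noteq> 0"
    using nontriv[OF i] by (auto simp: nontrivial_W_def)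
  obtain f where f: "f \<in> fvec T.B" "T.eW i (snd (W i) x) f \<noteq> 0"
    using T.eW_nonzero[OF i x ne] by blast
  have none: "{j. j < m \<and> lam' j = lam i} = {}" using nin by (metis (mono_tags, lifting) empty_Collect_eq imageI lessThan_iff)
  have "\<phi> (T.loc (lam i) x f) = T'.loc (lam i) x (\<phi> f)"
    by (rule loc_intertwine[OF T T' bij lin hom lam(1)[OF i] x(1) f(1)])
  also have "\<dots> = 0" unfolding T'.loc_def none by simp
  finally have "\<phi> (T.eW i (snd (W i) x) f) = \<phi> 0"
    unfolding T.loc_eq_eW[OF i lam(2)] using lin_on_0[OF lin] by simp
  then have "T.eW i (snd (W i) x) f = 0"
    using bij T.eW_fvec[OF i f(1) x(1)] fvec_0 unfolding bij_betw_def by (blast dest: inj_onD)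
  then show False using f(2) by simp
qed

section \<open>Matching the points and the factors of two isomorphic tensor products\<close>

theorem theorem35:
  fixes n m :: nat
    and W :: "nat \<Rightarrow> 'w rep" and W' :: "nat \<Rightarrow> 'x rep"
    and V :: "'v rep" and V' :: "'y rep"
    and lam lam' :: "nat \<Rightarrow> complex"
  assumes "\<forall>i<n. Wmod (W i) \<and> inO (W i) \<and> simple_for Wb (W i) \<and> nontrivial_W (W i)"
    and "\<forall>j<m. Wmod (W' j) \<and> inO (W' j) \<and> simple_for Wb (W' j) \<and> nontrivial_W (W' j)"
    and "Lmod V" "inO V" "simple_for UNIV V"
    and "Lmod V'" "inO V'" "simple_for UNIV V'"
    and "\<forall>i<n. lam i \<noteq> 0" "inj_on lam {..<n}"
    and "\<forall>j<m. lam' j \<noteq> 0" "inj_on lam' {..<m}"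
    and "iso_for UNIV (tens n (\<lambda>i. shift (lam i) (W i)) V) (tens m (\<lambda>j. shift (lam' j) (W' j)) V')"
  shows "m = n \<and> iso_for UNIV V V' \<and>
    (\<exists>\<sigma>. bij_betw \<sigma> {..<n} {..<n} \<and>
        (\<forall>i<n. lam i = lam' (\<sigma> i) \<and> iso_for Wb (W i) (W' (\<sigma> i))))"
proof -
  note W = assms(1)[rule_format] and W' = assms(2)[rule_format]
  note lam0 = assms(9)[rule_format] and lam0' = assms(11)[rule_format]
  note inj = assms(10) and inj' = assms(12)
  have T: "tensmod n W V"
    by (rule tensmod.intro) (use W assms(3,4) in \<open>blast intro: Wmod_endo Lmod_endo\<close>)+
  have T': "tensmod m W' V'"
    by (rule tensmod.intro) (use W' assms(6,7) in \<open>blast intro: Wmod_endo Lmod_endo\<close>)+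
  interpret T: tensmod n W V lam by (rule T)
  interpret T': tensmod m W' V' lam' by (rule T')
  obtain \<phi> where bij: "bij_betw \<phi> (fvec T.B) (fvec T'.B)" and lin: "lin_on (fvec T.B) \<phi>"
    and hom: "\<And>x f. f \<in> fvec T.B \<Longrightarrow> \<phi> (T.Z x f) = T'.Z x (\<phi> f)"
    using assms(13) unfolding iso_for_def by blast
  have \<phi>_in: "\<phi> f \<in> fvec T'.B" if "f \<in> fvec T.B" for f using bij that by (auto simp: bij_betw_def)
  have ne: "T.B \<noteq> {}" using W assms(5) by (intro T.B_nonempty) (auto simp: simple_for_def)
  have ne': "T'.B \<noteq> {}" using W' assms(8) by (intro T'.B_nonempty) (auto simp: simple_for_def)
  \<comment> \<open>The inverse is again a homomorphism, so \<open>lam_subset\<close> applies in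
    both directions.\<close>
  define \<psi> where "\<psi> = inv_into (fvec T.B) \<phi>"
  have \<psi>_in: "\<psi> g \<in> fvec T.B" and \<phi>\<psi>: "\<phi> (\<psi> g) = g" if "g \<in> fvec T'.B" for g
    using bij that unfolding \<psi>_def by (auto simp: bij_betw_def inv_into_into f_inv_into_f)
  have \<psi>\<phi>: "\<psi> (\<phi> f) = f" if "f \<in> fvec T.B" for f
    using bij that unfolding \<psi>_def by (simp add: bij_betw_def)
  have bij2: "bij_betw \<psi> (fvec T'.B) (fvec T.B)"
    unfolding \<psi>_def by (rule bij_betw_inv_into[OF bij])
  have lin2: "lin_on (fvec T'.B) \<psi>"
    unfolding lin_on_def
  proof (intro conjI ballI allI)
    fix f g assume fg: "f \<in> fvec T'.B" "g \<in> fvec T'.B"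
    have "\<psi> (f + g) = \<psi> (\<phi> (\<psi> f + \<psi> g))"
      using lin_on_add[OF lin \<psi>_in[OF fg(1)] \<psi>_in[OF fg(2)]] \<phi>\<psi>[OF fg(1)] \<phi>\<psi>[OF fg(2)] by simp
    then show "\<psi> (f + g) = \<psi> f + \<psi> g"
      using \<psi>\<phi>[OF fvec_add[OF \<psi>_in[OF fg(1)] \<psi>_in[OF fg(2)]]] by simp
  next
    fix c f assume f: "f \<in> fvec T'.B"
    have "\<psi> (smul c f) = \<psi> (\<phi> (smul c (\<psi> f)))"
      using lin_on_smul[OF lin \<psi>_in[OF f]] \<phi>\<psi>[OF f] by simp
    then show "\<psi> (smul c f) = smul c (\<psi> f)" using \<psi>\<phi>[OF fvec_smul[OF \<psi>_in[OF f]]] by simp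
  qed
  have hom2: "\<psi> (T'.Z x f) = T.Z x (\<psi> f)" if "f \<in> fvec T'.B" for x f
    using hom[OF \<psi>_in[OF that], of x] \<phi>\<psi>[OF that] \<psi>\<phi>[OF T.Z_fvec[OF \<psi>_in[OF that]], of x] by simp
  have sub: "lam ` {..<n} \<subseteq> lam' ` {..<m}"
    by (rule lam_subset[OF T T' bij lin hom lam0 inj _ ne]) (use W in auto)
  have sub': "lam' ` {..<m} \<subseteq> lam ` {..<n}"
    by (rule lam_subset[OF T' T bij2 lin2 hom2 lam0' inj' _ ne']) (use W' in auto)
  have eq: "lam ` {..<n} = lam' ` {..<m}" using sub sub' by blast
  have mn: "m = n" using card_image[OF inj] card_image[OF inj'] eq by simp
  \<comment> \<open>\<open>\<sigma> i\<close> is the index of the factor on the right that sits at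
    the same point as \<open>W i\<close>.\<close>
  define \<sigma> where "\<sigma> = inv_into {..<m} lam' \<circ> lam"
  have \<sigma>: "bij_betw \<sigma> {..<n} {..<n}"
  proof -
    have "bij_betw lam {..<n} (lam' ` {..<m})" using inj eq by (simp add: bij_betw_def)
    moreover have "bij_betw (inv_into {..<m} lam') (lam' ` {..<m}) {..<m}"
      by (rule bij_betw_inv_into[OF inj_on_imp_bij_betw[OF inj']])
    ultimately have "bij_betw \<sigma> {..<n} {..<m}" unfolding \<sigma>_def by (rule bij_betw_trans)
    then show ?thesis unfolding mn .
  qed
  have \<sigma>_lam: "lam' (\<sigma> i) = lam i" if "i < n" for i
    unfolding \<sigma>_def using eq that by (auto intro!: f_inv_into_f)
  have \<sigma>_in: "\<sigma> i < m" if "i < n" for i using \<sigma> that unfolding mn by (auto simp: bij_betw_def)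
  \<comment> \<open>As the points are distinct, exactly one factor on each side is based at
    \<open>lam i\<close>, so the localized action is the action on that factor alone.\<close>
  have homW: "\<phi> (T.eW i (snd (W i) x) f) = T'.eW (\<sigma> i) (snd (W' (\<sigma> i)) x) (\<phi> f)"
    if i: "i < n" and x: "x \<in> Wb" and f: "f \<in> fvec T.B" for i x f
    using loc_intertwine[OF T T' bij lin hom lam0[OF i] x f]
      T.loc_eq_eW[OF i inj, of x f] T'.loc_eq_eW[OF \<sigma>_in[OF i] inj', of x "\<phi> f"] \<sigma>_lam[OF i] by simp
  have isoW: "iso_for Wb (W i) (W' (\<sigma> i))" if i: "i < n" for i
    by (rule slot_iso[OF T.slotW[OF i] T'.slotW[OF \<sigma>_in[OF i]] bij lin _ _ _ _ homW[OF i] ne])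
      (use W[OF i] W'[OF \<sigma>_in[OF i]] T.W_endo[OF i] T'.W_endo[OF \<sigma>_in[OF i]] in auto)
  \<comment> \<open>Passage from \<open>Wb\<close> to all of L: the shifted actions of both matched
    factors are combinations of \<open>Wb\<close>-actions with equal coefficients, because the
    points agree. Central elements act by zero on both sides.\<close>
  have homS: "\<phi> (T.eW i (snd (T.sW i) x) f) = T'.eW (\<sigma> i) (snd (T'.sW (\<sigma> i)) x) (\<phi> f)"
    if i: "i < n" and f: "f \<in> fvec T.B" for i x f
  proof (cases x rule: Lb_gel_cases)
    case (1 c z)
    have gel: "gel c (int l) \<in> Wb" for l using Wb_gel by blast
    let ?b = "\<lambda>l. (of_int z gchoose l) * lam i powi (z - int l)"
    obtain N1 where N1: "\<And>N. N \<ge> N1 \<Longrightarrow> T.eW i (snd (T.sW i) x) f =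
        (\<Sum>l<N. smul (?b l) (T.eW i (snd (W i) (gel c (int l))) f))"
      using T.eW_shift[OF f i] unfolding 1 by blast
    obtain N2 where N2: "\<And>N. N \<ge> N2 \<Longrightarrow> T'.eW (\<sigma> i) (snd (T'.sW (\<sigma> i)) x) (\<phi> f) =
        (\<Sum>l<N. smul (?b l) (T'.eW (\<sigma> i) (snd (W' (\<sigma> i)) (gel c (int l))) (\<phi> f)))"
      using T'.eW_shift[OF \<phi>_in[OF f] \<sigma>_in[OF i], of c z] unfolding 1 \<sigma>_lam[OF i] by blast
    let ?N = "max N1 N2"
    have "\<phi> (T.eW i (snd (T.sW i) x) f) = (\<Sum>l<?N. smul (?b l) (\<phi> (T.eW i (snd (W i) (gel c (int l))) f)))"
      unfolding N1[OF max.cobounded1[of N1 N2]] by (rule lin_on_lincomb[OF lin]) (rule T.eW_fvec[OF i f gel])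
    also have "\<dots> = T'.eW (\<sigma> i) (snd (T'.sW (\<sigma> i)) x) (\<phi> f)"
      unfolding N2[OF max.cobounded2[of N2 N1]] homW[OF i gel f] ..
    finally show ?thesis .
  next
    case 2
    have "T.eW i (snd (T.sW i) x) f = 0" using i by (auto simp: T.eW_apply shift_central[OF 2])
    moreover have "T'.eW (\<sigma> i) (snd (T'.sW (\<sigma> i)) x) (\<phi> f) = 0"
      using \<sigma>_in[OF i] by (auto simp: T'.eW_apply shift_central[OF 2])
    ultimately show ?thesis using lin_on_0[OF lin] by simp
  qed
  \<comment> \<open>The full action minus the contributions of all shifted factors leaves the action
    on the last factor.\<close>
  have homV: "\<phi> (T.eV (snd V x) f) = T'.eV (snd V' x) (\<phi> f)" if f: "f \<in> fvec T.B" for x f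
  proof -
    let ?S = "\<Sum>i<n. T.eW i (snd (T.sW i) x) f" and ?S' = "\<Sum>j<m. T'.eW j (snd (T'.sW j) x) (\<phi> f)"
    have "\<phi> ?S = (\<Sum>i<n. \<phi> (T.eW i (snd (T.sW i) x) f))"
      by (rule lin_on_sum[OF lin]) (use T.eW_sfvec f in auto)
    also have "\<dots> = (\<Sum>i<n. T'.eW (\<sigma> i) (snd (T'.sW (\<sigma> i)) x) (\<phi> f))"
      using homS f by (intro sum.cong) auto
    also have "\<dots> = ?S'"
      unfolding mn by (rule sum.reindex_bij_betw[OF \<sigma>])
    finally have S: "\<phi> ?S = ?S'" .
    have "\<phi> ?S + \<phi> (T.eV (snd V x) f) = \<phi> (T.Z x f)"
      unfolding T.Z_eq[OF f] by (rule lin_on_add[OF lin, symmetric]) (use T.eW_sfvec T.eV_fvec f in \<open>auto intro: fvec_sum\<close>)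
    also have "\<dots> = ?S' + T'.eV (snd V' x) (\<phi> f)"
      unfolding hom[OF f] by (rule T'.Z_eq[OF \<phi>_in[OF f]])
    finally show ?thesis unfolding S by (rule add_left_imp_eq)
  qed
  have "iso_for UNIV V V'"
    by (rule slot_iso[OF T.slotV T'.slotV bij lin assms(5) T.V_endo assms(8) T'.V_endo homV ne])
  then show ?thesis using mn \<sigma> \<sigma>_lam isoW by auto
qed

end
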